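(* Let $Q$ be a smooth manifold, $(\Omega,\mathcal{F},P)$ a probability space, $[a,b]\subset\mathbb{R}$, $N\geq 2$, $h=(b-a)/N$ and $t_k=a+hk$. Let $L_d:\mathbb{R}\times\Omega\times Q\times Q\to\mathbb{R}$ be a stochastic discrete Lagrangian, sufficiently smooth in its last two arguments. Assume that almost surely the stochastic discrete Euler-Lagrange equations $$D_3L_d(t_k,\omega,q_k,q_{k+1})+D_4L_d(t_{k-1},\omega,q_{k-1},q_k)=0,\qquad k=1,\dots,N-1,$$ have, for each initial condition $(q_0,q_1)\in Q\times Q$, a unique solution $\{q_k\}_{k=0}^N$, depending smoothly on $(q_0,q_1)$. Let $G$ be a Lie group with Lie algebra $\mathfrak{g}$, acting on $Q$ on the left by $\Phi:G\times Q\to Q$, and suppose that $L_d$ is infinitesimally symmetric with respect to the diagonal action on $Q\times Q$, i.e. for every $\xi\in\mathfrak{g}$, $$\mathbf{d}L_d\cdot\xi_{Q\times Q}=\Theta^+\cdot\xi_{Q\times Q}+\Theta^-\cdot\xi_{Q\times Q}=0 .$$ Then the left and right discrete momentum maps coincide, $J^+=J^-=:J$, and almost surely $J$ is preserved by the discrete flow: every solution of the stochastic discrete Euler-Lagrange equations satisfies $$J(t_{N-1},\omega,q_{N-1},q_N)=J(t_0,\omega,q_0,q_1).$$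
   Context: The stochastic discrete Lagrangian has the form $L_d(t_k,\omega,q_k,q_{k+1})=\mathcal{L}_d(q_k,q_{k+1})+B_d(t_k,q_k,q_{k+1},\omega)$, where $\mathcal{L}_d:Q\times Q\to\mathbb{R}$ is a given discrete Lagrangian and $B_d(t_k,q_k,q_{k+1},\omega)\,h$ is a given random approximation of the sum of Stratonovich integrals $\sum_{i=1}^m\int_{t_k}^{t_{k+1}}\gamma_i(q(t))\circ dW_i$ for given potentials $\gamma_i:Q\to\mathbb{R}$ and independent Wiener processes $W_i$. $D_3L_d$ and $D_4L_d$ denote the differentials of $L_d(t,\omega,\cdot,\cdot)$ in its first and second $Q$-argument; $\mathbf{d}L_d$ is the differential on $Q\times Q$ with $t,\omega$ fixed. The one-forms on $Q\times Q$ (for fixed $t_k,\omega$) are $$\Theta^+(t_k,\omega,q_k,q_{k+1})\cdot(\delta q_k,\delta q_{k+1})=D_4L_d(t_k,\omega,q_k,q_{k+1})\cdot\delta q_{k+1},$$ $$\Theta^-(t_k,\omega,q_k,q_{k+1})\cdot(\delta q_k,\delta q_{k+1})=D_3L_d(t_k,\omega,q_k,q_{k+1})\cdot\delta q_k.$$ The diagonal action is $\Phi_{Q\times Q}(g,q_1,q_2)=(\Phi(g,q_1),\Phi(g,q_2))$, with infinitesimal generator $\xi_{Q\times Q}(q_1,q_2)=\frac{d}{ds}\Phi_{Q\times Q}(\exp(s\xi),q_1,q_2)|_{s=0}$, $\xi\in\mathfrak{g}$. The discrete momentum maps $J^+,J^-$ (with values in $\mathfrak{g}^*$, depending also on $t_k$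 and $\omega$) are defined by $J^+\cdot\xi=\Theta^+\cdot\xi_{Q\times Q}$ and $J^-\cdot\xi=-\Theta^-\cdot\xi_{Q\times Q}$ for all $\xi\in\mathfrak{g}$. *)

theory Defs
  imports "HOL-Analysis.Analysis" "HOL-Probability.Probability" "HOL-Algebra.Group_Action"
    "HOL-Library.Extended_Nat"
begin

section \<open>Maps of class $C^r$ between normed spaces\<close>

text \<open>Meant for open \<open>S\<close>.\<close>

primrec times_differentiable_on ::
  "nat \<Rightarrow> 'a::real_normed_vector set \<Rightarrow> ('a \<Rightarrow> 'b::real_normed_vector) \<Rightarrow> bool" where
  "times_differentiable_on 0 S f \<longleftrightarrow> continuous_on S f"
| "times_differentiable_on (Suc n) S f \<longleftrightarrow>
     (\<forall>x\<in>S. f differentiable (at x)) \<and>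
     (\<forall>v. times_differentiable_on n S (\<lambda>x. frechet_derivative f (at x) v))"

definition Cr_on ::
  "enat \<Rightarrow> 'a::real_normed_vector set \<Rightarrow> ('a \<Rightarrow> 'b::real_normed_vector) \<Rightarrow> bool" where
  "Cr_on r S f \<longleftrightarrow> (\<forall>n. enat n \<le> r \<longrightarrow> times_differentiable_on n S f)"


section \<open>Smooth manifolds\<close>

text \<open>A chart is a pair of a domain and a coordinate map; the coordinate map is only
  relevant on the domain.\<close>

type_synonym ('a, 'e) chart = "'a set \<times> ('a \<Rightarrow> 'e)"

abbreviation dom_of :: "('a, 'e) chart \<Rightarrow> 'a set" where "dom_of \<equiv> fst"
abbreviation coord :: "('a, 'e) chart \<Rightarrow> 'a \<Rightarrow> 'e" where "coord \<equiv> snd"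

definition param :: "('a, 'e) chart \<Rightarrow> 'e \<Rightarrow> 'a" where
  "param c = inv_into (dom_of c) (coord c)"

text \<open>The atlas is an arbitrary smooth atlas; it need not be maximal.\<close>

record ('a, 'e) mfd =
  mfd_top :: "'a topology"
  atlas :: "('a, 'e) chart set"

abbreviation points :: "('a, 'e) mfd \<Rightarrow> 'a set" where
  "points M \<equiv> topspace (mfd_top M)"

definition is_chart :: "'a topology \<Rightarrow> ('a, 'e::euclidean_space) chart \<Rightarrow> bool" where
  "is_chart X c \<longleftrightarrow>
     openin X (dom_of c) \<and> open (coord c ` dom_of c) \<and>
     homeomorphic_map (subtopology X (dom_of c)) (top_of_set (coord c ` dom_of c)) (coord c)"

definition smooth_manifold :: "('a, 'e::euclidean_space) mfd \<Rightarrow> bool" where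
  "smooth_manifold M \<longleftrightarrow>
     Hausdorff_space (mfd_top M) \<and> second_countable (mfd_top M) \<and>
     (\<forall>c\<in>atlas M. is_chart (mfd_top M) c) \<and>
     (\<Union>c\<in>atlas M. dom_of c) = points M \<and>
     (\<forall>c\<in>atlas M. \<forall>d\<in>atlas M.
        Cr_on \<infinity> (coord c ` (dom_of c \<inter> dom_of d)) (coord d \<circ> param c))"

definition prod_mfd :: "('a, 'e) mfd \<Rightarrow> ('b, 'f) mfd \<Rightarrow> ('a \<times> 'b, 'e \<times> 'f) mfd" where
  "prod_mfd M N =
     \<lparr>mfd_top = prod_topology (mfd_top M) (mfd_top N),
      atlas = {(dom_of c \<times> dom_of d, map_prod (coord c) (coord d)) | c d.
                 c \<in> atlas M \<and> d \<in> atlas N}\<rparr>"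

definition euclidean_mfd :: "('e::euclidean_space, 'e) mfd" where
  "euclidean_mfd = \<lparr>mfd_top = euclidean, atlas = {(UNIV, id)}\<rparr>"

definition Cr_map ::
  "enat \<Rightarrow> ('a, 'e::euclidean_space) mfd \<Rightarrow> ('b, 'f::euclidean_space) mfd \<Rightarrow> ('a \<Rightarrow> 'b) \<Rightarrow> bool"
where
  "Cr_map r M N f \<longleftrightarrow>
     continuous_map (mfd_top M) (mfd_top N) f \<and>
     (\<forall>c\<in>atlas M. \<forall>d\<in>atlas N.
        Cr_on r (coord c ` (dom_of c \<inter> f -` dom_of d)) (coord d \<circ> f \<circ> param c))"

abbreviation smooth_map ::
  "('a, 'e::euclidean_space) mfd \<Rightarrow> ('b, 'f::euclidean_space) mfd \<Rightarrow> ('a \<Rightarrow> 'b) \<Rightarrow> bool" where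
  "smooth_map \<equiv> Cr_map \<infinity>"


section \<open>Tangent vectors and differentials\<close>

definition charts_at :: "('a, 'e) mfd \<Rightarrow> 'a \<Rightarrow> ('a, 'e) chart set" where
  "charts_at M q = {c \<in> atlas M. q \<in> dom_of c}"

definition chart_at :: "('a, 'e) mfd \<Rightarrow> 'a \<Rightarrow> ('a, 'e) chart" where
  "chart_at M q = (SOME c. c \<in> charts_at M q)"

text \<open>A tangent vector at \<open>q\<close> is the family of its coordinate representations in the charts
  around \<open>q\<close>, related to each other by the derivatives of the coordinate changes.\<close>

type_synonym ('a, 'e) tvec = "('a, 'e) chart \<Rightarrow> 'e"

definition tangent_space :: "('a, 'e::euclidean_space) mfd \<Rightarrow> 'a \<Rightarrow> ('a, 'e) tvec set" where
  "tangent_space M q =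
     {v. (\<forall>c. c \<notin> charts_at M q \<longrightarrow> v c = 0) \<and>
         (\<forall>c\<in>charts_at M q. \<forall>d\<in>charts_at M q.
            v d = frechet_derivative (coord d \<circ> param c) (at (coord c q)) (v c))}"

definition tscale :: "real \<Rightarrow> ('a, 'e::real_vector) tvec \<Rightarrow> ('a, 'e) tvec" where
  "tscale s v = (\<lambda>c. s *\<^sub>R v c)"

text \<open>In the next two definitions the value on a tangent vector does not depend on the choice
  of the chart around \<open>q\<close>.\<close>

definition tangent_map ::
  "('a, 'e::euclidean_space) mfd \<Rightarrow> ('b, 'f::euclidean_space) mfd \<Rightarrow> ('a \<Rightarrow> 'b) \<Rightarrow> 'a \<Rightarrow>
     ('a, 'e) tvec \<Rightarrow> ('b, 'f) tvec" where
  "tangent_map M N f q v =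
     (let c = chart_at M q in
      (\<lambda>d. if d \<in> charts_at N (f q)
           then frechet_derivative (coord d \<circ> f \<circ> param c) (at (coord c q)) (v c) else 0))"

definition differential ::
  "('a, 'e::euclidean_space) mfd \<Rightarrow> ('a \<Rightarrow> real) \<Rightarrow> 'a \<Rightarrow> ('a, 'e) tvec \<Rightarrow> real" where
  "differential M f q v =
     (let c = chart_at M q in frechet_derivative (f \<circ> param c) (at (coord c q)) (v c))"

definition velocity ::
  "('a, 'e::euclidean_space) mfd \<Rightarrow> (real \<Rightarrow> 'a) \<Rightarrow> real \<Rightarrow> ('a, 'e) tvec" where
  "velocity M \<gamma> s =
     (\<lambda>d. if d \<in> charts_at M (\<gamma> s) then vector_derivative (coord d \<circ> \<gamma>) (at s) else 0)"

definition differentiable_curve :: "('a, 'e::euclidean_space) mfd \<Rightarrow> (real \<Rightarrow> 'a) \<Rightarrow> bool" where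
  "differentiable_curve M \<gamma> \<longleftrightarrow>
     continuous_map euclidean (mfd_top M) \<gamma> \<and>
     (\<forall>s. \<forall>d\<in>charts_at M (\<gamma> s). (coord d \<circ> \<gamma>) differentiable (at s))"

definition integral_curve ::
  "('a, 'e::euclidean_space) mfd \<Rightarrow> ('a \<Rightarrow> ('a, 'e) tvec) \<Rightarrow> (real \<Rightarrow> 'a) \<Rightarrow> bool" where
  "integral_curve M X \<gamma> \<longleftrightarrow>
     differentiable_curve M \<gamma> \<and> (\<forall>s. velocity M \<gamma> s = X (\<gamma> s))"


section \<open>Lie groups and their actions\<close>

definition lie_group :: "'g monoid \<Rightarrow> ('g, 'e::euclidean_space) mfd \<Rightarrow> bool" where
  "lie_group G M \<longleftrightarrow>
     group G \<and> smooth_manifold M \<and> points M = carrier G \<and>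
     smooth_map (prod_mfd M M) M (\<lambda>(g, h). g \<otimes>\<^bsub>G\<^esub> h) \<and>
     smooth_map M M (\<lambda>g. inv\<^bsub>G\<^esub> g)"

definition lie_algebra :: "'g monoid \<Rightarrow> ('g, 'e::euclidean_space) mfd \<Rightarrow> ('g, 'e) tvec set" where
  "lie_algebra G M = tangent_space M \<one>\<^bsub>G\<^esub>"

definition left_invariant_field ::
  "'g monoid \<Rightarrow> ('g, 'e::euclidean_space) mfd \<Rightarrow> ('g, 'e) tvec \<Rightarrow> 'g \<Rightarrow> ('g, 'e) tvec" where
  "left_invariant_field G M \<xi> g = tangent_map M M (\<lambda>h. g \<otimes>\<^bsub>G\<^esub> h) \<one>\<^bsub>G\<^esub> \<xi>"

text \<open>The time-one point of the integral curve through the identity of the left-invariant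
  vector field generated by \<open>\<xi>\<close>.\<close>

definition lie_exp ::
  "'g monoid \<Rightarrow> ('g, 'e::euclidean_space) mfd \<Rightarrow> ('g, 'e) tvec \<Rightarrow> 'g" where
  "lie_exp G M \<xi> =
     (THE \<gamma>. integral_curve M (left_invariant_field G M \<xi>) \<gamma> \<and> \<gamma> 0 = \<one>\<^bsub>G\<^esub>) 1"

definition smooth_left_action ::
  "'g monoid \<Rightarrow> ('g, 'e::euclidean_space) mfd \<Rightarrow> ('q, 'f::euclidean_space) mfd \<Rightarrow>
     ('g \<Rightarrow> 'q \<Rightarrow> 'q) \<Rightarrow> bool" where
  "smooth_left_action G M Q \<Phi> \<longleftrightarrow>
     group_action G (points Q) \<Phi> \<and> smooth_map (prod_mfd M Q) Q (\<lambda>(g, q). \<Phi> g q)"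

definition diagonal_action :: "('g \<Rightarrow> 'q \<Rightarrow> 'q) \<Rightarrow> 'g \<Rightarrow> 'q \<times> 'q \<Rightarrow> 'q \<times> 'q" where
  "diagonal_action \<Phi> g = (\<lambda>(q1, q2). (\<Phi> g q1, \<Phi> g q2))"

definition infinitesimal_generator ::
  "'g monoid \<Rightarrow> ('g, 'e::euclidean_space) mfd \<Rightarrow> ('q, 'f::euclidean_space) mfd \<Rightarrow>
     ('g \<Rightarrow> 'q \<Rightarrow> 'q) \<Rightarrow> ('g, 'e) tvec \<Rightarrow> 'q \<Rightarrow> ('q, 'f) tvec" where
  "infinitesimal_generator G M Q \<Psi> \<xi> q = velocity Q (\<lambda>s. \<Psi> (lie_exp G M (tscale s \<xi>)) q) 0"


section \<open>Stochastic discrete Lagrangians\<close>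

text \<open>The only structural requirement on the noise term \<open>B\<close> is that it is random: being an
  approximation of a Stratonovich integral is a statement about where \<open>B\<close> comes from.\<close>

definition stochastic_discrete_lagrangian ::
  "'w measure \<Rightarrow> ('q, 'e::euclidean_space) mfd \<Rightarrow> ('q \<Rightarrow> 'q \<Rightarrow> real) \<Rightarrow>
     (real \<Rightarrow> 'q \<Rightarrow> 'q \<Rightarrow> 'w \<Rightarrow> real) \<Rightarrow> (real \<Rightarrow> 'w \<Rightarrow> 'q \<Rightarrow> 'q \<Rightarrow> real) \<Rightarrow> bool" where
  "stochastic_discrete_lagrangian P Q Ld B L \<longleftrightarrow>
     (\<forall>t. \<forall>x\<in>points Q. \<forall>y\<in>points Q.
        B t x y \<in> borel_measurable P \<and>
        (\<forall>\<omega>\<in>space P. L t \<omega> x y = Ld x y + B t x y \<omega>))"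

text \<open>In the following, \<open>f\<close> stands for the function \<open>L t \<omega>\<close> on \<open>Q \<times> Q\<close> with \<open>t\<close> and \<open>\<omega>\<close> fixed,
  so that \<open>D_fst\<close> and \<open>D_snd\<close> are the differentials $D_3$ and $D_4$ of \<open>L\<close>.\<close>

definition D_fst ::
  "('q, 'e::euclidean_space) mfd \<Rightarrow> ('q \<Rightarrow> 'q \<Rightarrow> real) \<Rightarrow> 'q \<Rightarrow> 'q \<Rightarrow> ('q, 'e) tvec \<Rightarrow> real" where
  "D_fst Q f x y = differential Q (\<lambda>x'. f x' y) x"

definition D_snd ::
  "('q, 'e::euclidean_space) mfd \<Rightarrow> ('q \<Rightarrow> 'q \<Rightarrow> real) \<Rightarrow> 'q \<Rightarrow> 'q \<Rightarrow> ('q, 'e) tvec \<Rightarrow> real" where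
  "D_snd Q f x y = differential Q (\<lambda>y'. f x y') y"

text \<open>The components of a tangent vector of \<open>Q \<times> Q\<close> are its images under the tangent maps of the
  two projections.\<close>

definition theta_plus ::
  "('q, 'e::euclidean_space) mfd \<Rightarrow> ('q \<Rightarrow> 'q \<Rightarrow> real) \<Rightarrow> 'q \<Rightarrow> 'q \<Rightarrow>
     ('q \<times> 'q, 'e \<times> 'e) tvec \<Rightarrow> real" where
  "theta_plus Q f x y w = D_snd Q f x y (tangent_map (prod_mfd Q Q) Q snd (x, y) w)"

definition theta_minus ::
  "('q, 'e::euclidean_space) mfd \<Rightarrow> ('q \<Rightarrow> 'q \<Rightarrow> real) \<Rightarrow> 'q \<Rightarrow> 'q \<Rightarrow>
     ('q \<times> 'q, 'e \<times> 'e) tvec \<Rightarrow> real" where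
  "theta_minus Q f x y w = D_fst Q f x y (tangent_map (prod_mfd Q Q) Q fst (x, y) w)"

definition diagonal_generator ::
  "'g monoid \<Rightarrow> ('g, 'd::euclidean_space) mfd \<Rightarrow> ('q, 'e::euclidean_space) mfd \<Rightarrow>
     ('g \<Rightarrow> 'q \<Rightarrow> 'q) \<Rightarrow> ('g, 'd) tvec \<Rightarrow> 'q \<Rightarrow> 'q \<Rightarrow> ('q \<times> 'q, 'e \<times> 'e) tvec" where
  "diagonal_generator G M Q \<Phi> \<xi> x y =
     infinitesimal_generator G M (prod_mfd Q Q) (diagonal_action \<Phi>) \<xi> (x, y)"

definition momentum_plus ::
  "'g monoid \<Rightarrow> ('g, 'd::euclidean_space) mfd \<Rightarrow> ('q, 'e::euclidean_space) mfd \<Rightarrow>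
     ('g \<Rightarrow> 'q \<Rightarrow> 'q) \<Rightarrow> ('q \<Rightarrow> 'q \<Rightarrow> real) \<Rightarrow> 'q \<Rightarrow> 'q \<Rightarrow> ('g, 'd) tvec \<Rightarrow> real" where
  "momentum_plus G M Q \<Phi> f x y =
     (\<lambda>\<xi>\<in>lie_algebra G M. theta_plus Q f x y (diagonal_generator G M Q \<Phi> \<xi> x y))"

definition momentum_minus ::
  "'g monoid \<Rightarrow> ('g, 'd::euclidean_space) mfd \<Rightarrow> ('q, 'e::euclidean_space) mfd \<Rightarrow>
     ('g \<Rightarrow> 'q \<Rightarrow> 'q) \<Rightarrow> ('q \<Rightarrow> 'q \<Rightarrow> real) \<Rightarrow> 'q \<Rightarrow> 'q \<Rightarrow> ('g, 'd) tvec \<Rightarrow> real" where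
  "momentum_minus G M Q \<Phi> f x y =
     (\<lambda>\<xi>\<in>lie_algebra G M. - theta_minus Q f x y (diagonal_generator G M Q \<Phi> \<xi> x y))"

definition infinitesimally_symmetric ::
  "'g monoid \<Rightarrow> ('g, 'd::euclidean_space) mfd \<Rightarrow> ('q, 'e::euclidean_space) mfd \<Rightarrow>
     ('g \<Rightarrow> 'q \<Rightarrow> 'q) \<Rightarrow> ('q \<Rightarrow> 'q \<Rightarrow> real) \<Rightarrow> bool" where
  "infinitesimally_symmetric G M Q \<Phi> f \<longleftrightarrow>
     (\<forall>\<xi>\<in>lie_algebra G M. \<forall>x\<in>points Q. \<forall>y\<in>points Q.
        differential (prod_mfd Q Q) (\<lambda>(x', y'). f x' y') (x, y)
          (diagonal_generator G M Q \<Phi> \<xi> x y) = 0)"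

text \<open>Here \<open>F k\<close> stands for \<open>L (t k) \<omega>\<close>. The equation is an equality of covectors at \<open>q k\<close>.\<close>

definition discrete_EL_solution ::
  "('q, 'e::euclidean_space) mfd \<Rightarrow> nat \<Rightarrow> (nat \<Rightarrow> 'q \<Rightarrow> 'q \<Rightarrow> real) \<Rightarrow> (nat \<Rightarrow> 'q) \<Rightarrow> bool" where
  "discrete_EL_solution Q N F q \<longleftrightarrow>
     (\<forall>k\<le>N. q k \<in> points Q) \<and>
     (\<forall>k\<in>{1..N - 1}. \<forall>v\<in>tangent_space Q (q k).
        D_fst Q (F k) (q k) (q (k + 1)) v + D_snd Q (F (k - 1)) (q (k - 1)) (q k) v = 0)"

definition uniquely_solvable ::
  "enat \<Rightarrow> ('q, 'e::euclidean_space) mfd \<Rightarrow> nat \<Rightarrow> (nat \<Rightarrow> 'q \<Rightarrow> 'q \<Rightarrow> real) \<Rightarrow> bool" where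
  "uniquely_solvable s Q N F \<longleftrightarrow>
     (\<exists>flow :: 'q \<times> 'q \<Rightarrow> nat \<Rightarrow> 'q.
        (\<forall>x\<in>points Q. \<forall>y\<in>points Q.
           discrete_EL_solution Q N F (flow (x, y)) \<and> flow (x, y) 0 = x \<and> flow (x, y) 1 = y \<and>
           (\<forall>q. discrete_EL_solution Q N F q \<and> q 0 = x \<and> q 1 = y \<longrightarrow>
                (\<forall>k\<le>N. q k = flow (x, y) k))) \<and>
        (\<forall>k\<le>N. Cr_map s (prod_mfd Q Q) Q (\<lambda>z. flow z k)))"

end

theory Submission
  imports Defs
begin

text \<open>Left-invariant vector fields on a Lie group have unique global integral curves, so
  \<open>s \<mapsto> exp (s \<xi>)\<close> is differentiable and the generator of the diagonal action splits as
  $\xi_{Q \times Q}(x, y) = (\xi_Q(x), \xi_Q(y))$. Hence $J^+ \cdot \xi = D_4 L_d \cdot \xi_Q(q_{k+1})$ and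
  $J^- \cdot \xi = - D_3 L_d \cdot \xi_Q(q_k)$. Infinitesimal symmetry says that the two agree, and the
  discrete Euler-Lagrange equation at $q_k$, applied to the vector $\xi_Q(q_k)$, says that $J^-$ on
  $(q_k, q_{k+1})$ equals $J^+$ on $(q_{k-1}, q_k)$.\<close>

section \<open>Autonomous differential equations\<close>

text \<open>Since \<open>lie_exp\<close> is a definite description, nothing can be said about a
  generator before global integral curves are known to exist and to be unique. In coordinates a
  left-invariant field is the derivative of the multiplication at \<open>(g, \<one>)\<close> in a
  fixed direction, hence C^1 and locally Lipschitz; left translation extends its solutions to all
  times, and the Hausdorff property makes them unique. Rescaling time turns the exponential of
  \<open>s\<close> times \<open>\<xi>\<close> into one fixed curve evaluated at \<open>s\<close>, so
  no smooth dependence on \<open>\<xi>\<close> enters. The other obstacle is the choice of charts: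
  \<open>differential\<close> and \<open>tangent_map\<close> read a vector in a chart picked by
  \<open>SOME\<close>, and the chart picked on a product need not consist of those picked on the
  factors. Derivatives are therefore treated between two arbitrary charts, with a chain rule, and
  coordinate changes mediate between choices.\<close>

lemma C1_locally_lipschitz:
  fixes f :: "'a::euclidean_space \<Rightarrow> 'b::real_normed_vector"
  assumes f: "times_differentiable_on (Suc 0) S f" and "open S" "x0 \<in> S"
  obtains r L where "r > 0" "cball x0 r \<subseteq> S" "L-lipschitz_on (cball x0 r) f"
proof -
  obtain r where r: "r > 0" "cball x0 r \<subseteq> S"
    using assms open_contains_cball by blast
  let ?D = "\<lambda>x. frechet_derivative f (at x)"
  \<comment> \<open>\<open>times_differentiable_on\<close> only makes each directional derivative
    continuous. This sum is continuous and dominates the operator norm, so compactness of the ball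
    yields a uniform bound.\<close>
  let ?g = "\<lambda>x. \<Sum>b\<in>Basis. norm (?D x b)"
  have D: "(f has_derivative ?D x) (at x)" if "x \<in> S" for x
    using f that by (simp add: frechet_derivative_works)
  have "continuous_on (cball x0 r) ?g"
    using f r(2) by (auto intro!: continuous_intros intro: continuous_on_subset)
  then have "bounded (?g ` cball x0 r)"
    using compact_continuous_image compact_imp_bounded compact_cball by blast
  then obtain L where "L > 0" and L: "\<And>x. x \<in> cball x0 r \<Longrightarrow> norm (?g x) \<le> L"
    by (auto simp: bounded_pos)
  have onorm: "onorm (?D x) \<le> L" if "x \<in> cball x0 r" for x
  proof (rule onorm_le)
    fix v
    have "x \<in> S" using that r by blast
    then have lin: "linear (?D x)"
      using D has_derivative_linear by blast
    have "?D x v = ?D x (\<Sum>b\<in>Basis. (v \<bullet> b) *\<^sub>R b)"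
      by (simp add: euclidean_representation)
    also have "\<dots> = (\<Sum>b\<in>Basis. (v \<bullet> b) *\<^sub>R ?D x b)"
      by (simp add: linear_sum[OF lin] linear_cmul[OF lin])
    also have "norm \<dots> \<le> (\<Sum>b\<in>Basis. norm v * norm (?D x b))"
      by (rule sum_norm_le) (simp add: Basis_le_norm mult_right_mono)
    also have "\<dots> = norm v * ?g x"
      by (simp add: sum_distrib_left)
    also have "\<dots> \<le> norm v * L"
      using L[OF that] by (intro mult_left_mono) auto
    finally show "norm (?D x v) \<le> L * norm v"
      by (simp add: mult.commute)
  qed
  have "L-lipschitz_on (cball x0 r) f"
  proof (rule lipschitz_onI)
    fix x y assume "x \<in> cball x0 r" "y \<in> cball x0 r"
    then show "dist (f x) (f y) \<le> L * dist x y"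
      unfolding dist_norm
      using differentiable_bound[OF convex_cball has_derivative_at_withinI[OF D] onorm, of x0 r x y] r
      by blast
  qed (use \<open>L > 0\<close> in auto)
  with r that show ?thesis by blast
qed

text \<open>Picard iteration. Composing \<open>f\<close> with the nearest-point projection onto the
  ball gives a bounded, globally Lipschitz field, so the integral operator acts on all bounded
  continuous curves. A short time interval keeps the fixed point in the ball, where the new field
  agrees with \<open>f\<close>.\<close>

lemma ode_local_existence:
  fixes f :: "'a::euclidean_space \<Rightarrow> 'a"
  assumes "r > 0" and lip: "L-lipschitz_on (cball x0 r) f"
  obtains \<epsilon> and u :: "real \<Rightarrow> 'a" where "\<epsilon> > 0" "u 0 = x0"
    "\<forall>s. \<bar>s\<bar> < \<epsilon> \<longrightarrow> u s \<in> cball x0 r \<and> (u has_vector_derivative f (u s)) (at s)"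
proof -
  let ?p = "closest_point (cball x0 r)"
  \<comment> \<open>A bound for \<open>f\<close> on the ball; the summand 1 keeps it
    positive.\<close>
  define K where "K = norm (f x0) + L * r + 1"
  \<comment> \<open>The first bound gives \<open>\<epsilon> * K \<le> r\<close>, so the solution
    cannot leave the ball; the second gives the contraction factor 1/2. Adding 1 to \<open>L\<close>
    admits \<open>L = 0\<close>.\<close>
  define \<epsilon> where "\<epsilon> = min (r / K) (1 / (2 * (L + 1)))"
  define F where "F y = f (?p y)" for y
  \<comment> \<open>The signed integral from 0 to \<open>s\<close>; starting both integrals at
    \<open>-\<epsilon>\<close> avoids a case distinction for negative \<open>s\<close>.\<close>
  define I where "I g s = integral {-\<epsilon>..s} g - integral {-\<epsilon>..0} g" for g :: "real \<Rightarrow> 'a" and s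
  have L0: "L \<ge> 0" using lip lipschitz_on_nonneg by blast
  have K0: "K > 0" unfolding K_def
    by (intro add_nonneg_pos add_nonneg_nonneg mult_nonneg_nonneg) (use L0 \<open>r > 0\<close> in auto)
  have e0: "\<epsilon> > 0" using K0 L0 \<open>r > 0\<close> by (simp add: \<epsilon>_def)
  have eK: "\<epsilon> * K \<le> r"
    using K0 by (auto simp: \<epsilon>_def min_def field_simps)
  have eL: "\<epsilon> * L \<le> 1/2"
  proof -
    have "\<epsilon> * L \<le> 1 / (2 * (L + 1)) * L"
      by (rule mult_right_mono) (use L0 in \<open>auto simp: \<epsilon>_def\<close>)
    also have "\<dots> \<le> 1/2" using L0 by (simp add: field_simps)
    finally show ?thesis .
  qed
  have p_in: "?p y \<in> cball x0 r" for y
    using \<open>r > 0\<close> by (intro closest_point_in_set) auto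
  have F_lip: "dist (F y) (F z) \<le> L * dist y z" for y z
  proof -
    have "dist (F y) (F z) \<le> L * dist (?p y) (?p z)"
      unfolding F_def by (rule lipschitz_onD[OF lip p_in p_in])
    also have "\<dots> \<le> L * dist y z"
      using \<open>r > 0\<close> by (intro mult_left_mono L0 closest_point_lipschitz) auto
    finally show ?thesis .
  qed
  have F_bound: "norm (F y) \<le> K" for y
  proof -
    have "norm (f (?p y) - f x0) \<le> L * dist (?p y) x0"
      using lipschitz_onD[OF lip p_in[of y], of x0] \<open>r > 0\<close> by (simp add: dist_norm)
    also have "\<dots> \<le> L * r"
      using p_in[of y] by (intro mult_left_mono L0) (auto simp: dist_commute)
    finally show ?thesis
      unfolding F_def K_def using norm_triangle_sub[of "f (?p y)" "f x0"] by linarith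
  qed
  have "L-lipschitz_on UNIV F"
    using F_lip L0 by (auto intro: lipschitz_onI)
  then have F_cont: "continuous_on UNIV F"
    using lipschitz_on_continuous_on by blast
  have Fx: "continuous_on A (\<lambda>s. F (x s))" if "continuous_on A x" for A and x :: "real \<Rightarrow> 'a"
    by (rule continuous_on_compose2[OF F_cont that]) auto
  have I0: "I g 0 = 0" for g by (simp add: I_def)
  have I': "(I g has_vector_derivative g s) (at s within {-\<epsilon>..\<epsilon>})"
    if "continuous_on {-\<epsilon>..\<epsilon>} g" "s \<in> {-\<epsilon>..\<epsilon>}" for g s
    unfolding I_def
    using has_vector_derivative_diff[OF integral_has_vector_derivative[OF that] has_vector_derivative_const]
    by simp
  have I_le: "norm (I g s - I g' s) \<le> \<epsilon> * C"
    if "continuous_on {-\<epsilon>..\<epsilon>} g" "continuous_on {-\<epsilon>..\<epsilon>} g'" "s \<in> {-\<epsilon>..\<epsilon>}"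
      "\<And>s. norm (g s - g' s) \<le> C" for g g' s C
  proof -
    have C0: "C \<ge> 0" using norm_ge_zero order_trans that(4) by blast
    \<comment> \<open>The mean value inequality, applied to a difference of antiderivatives that
      vanishes at 0.\<close>
    have "norm ((I g s - I g' s) - (I g 0 - I g' 0)) \<le> C * norm (s - 0)"
    proof (rule differentiable_bound[of "{-\<epsilon>..\<epsilon>}" _ "\<lambda>s h. h *\<^sub>R (g s - g' s)"])
      show "((\<lambda>s. I g s - I g' s) has_derivative (\<lambda>h. h *\<^sub>R (g x - g' x))) (at x within {-\<epsilon>..\<epsilon>})"
        if "x \<in> {-\<epsilon>..\<epsilon>}" for x
        using has_vector_derivative_diff[OF I' I'] \<open>continuous_on {-\<epsilon>..\<epsilon>} g\<close>
          \<open>continuous_on {-\<epsilon>..\<epsilon>} g'\<close> that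
        unfolding has_vector_derivative_def by blast
      show "onorm (\<lambda>h. h *\<^sub>R (g x - g' x)) \<le> C" for x
        by (rule onorm_le) (simp add: mult.commute[of "\<bar>_\<bar>"] mult_right_mono that(4))
    qed (use that e0 in auto)
    also have "\<dots> \<le> C * \<epsilon>"
      using that(3) C0 by (intro mult_left_mono) auto
    finally show ?thesis by (simp add: I0 mult.commute)
  qed
  \<comment> \<open>Freezing the iterates outside the interval makes them bounded continuous
    functions on the whole line, which form a complete space.\<close>
  define c where "c = clamp (-\<epsilon>) \<epsilon>"
  have c_in: "c s \<in> {-\<epsilon>..\<epsilon>}" for s
    using clamp_in_interval[of "-\<epsilon>" \<epsilon> s] e0 by (simp add: c_def cbox_interval)
  have c_id: "c s = s" if "s \<in> {-\<epsilon>..\<epsilon>}" for s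
    using that clamp_cancel_cbox[of s "-\<epsilon>" \<epsilon>] by (simp add: c_def cbox_interval)
  have I_bound: "norm (I (\<lambda>s. F (x s)) s) \<le> \<epsilon> * K" if "continuous_on UNIV x" "s \<in> {-\<epsilon>..\<epsilon>}" for x s
    using I_le[of "\<lambda>s. F (x s)" "\<lambda>_. 0" s K] that F_bound Fx[OF continuous_on_subset[OF that(1)]]
    by (simp add: I_def)
  have "\<exists>y :: real \<Rightarrow>\<^sub>C 'a. \<forall>s. y s = x0 + I (\<lambda>s. F (x s)) (c s)" for x :: "real \<Rightarrow>\<^sub>C 'a"
  proof -
    have "continuous_on {-\<epsilon>..\<epsilon>} (I (\<lambda>s. F (x s)))"
      by (rule continuous_on_vector_derivative[where f'="\<lambda>s. F (x s)"]) (intro I' Fx; simp)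
    then have "continuous_on UNIV (ext_cont (I (\<lambda>s. F (x s))) (-\<epsilon>) \<epsilon>)"
      by (intro continuous_on_ext_cont) (simp add: cbox_interval)
    then have "(\<lambda>s. x0 + I (\<lambda>s. F (x s)) (c s)) \<in> bcontfun"
      unfolding ext_cont_def c_def[symmetric]
    proof (intro bcontfun_normI[where b="norm x0 + \<epsilon> * K"])
      show "norm (x0 + I (\<lambda>s. F (x s)) (c s)) \<le> norm x0 + \<epsilon> * K" for s
        using I_bound[OF continuous_on_apply_bcontfun c_in, of x s]
        by (meson add_left_mono norm_triangle_le)
    qed (intro continuous_intros)
    then show ?thesis by (metis bcontfunE)
  qed
  then obtain T :: "(real \<Rightarrow>\<^sub>C 'a) \<Rightarrow> (real \<Rightarrow>\<^sub>C 'a)"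
    where T: "\<And>x s. T x s = x0 + I (\<lambda>s. F (x s)) (c s)" by metis
  have "dist (T x) (T y) \<le> 1/2 * dist x y" for x y
  proof (rule dist_bound)
    fix s
    have "dist (F (x s)) (F (y s)) \<le> L * dist x y" for s
      by (rule order_trans[OF F_lip mult_left_mono[OF dist_bounded L0]])
    then have "norm (I (\<lambda>s. F (x s)) (c s) - I (\<lambda>s. F (y s)) (c s)) \<le> \<epsilon> * (L * dist x y)"
      by (intro I_le Fx c_in) (auto simp: dist_norm)
    then have "dist (T x s) (T y s) \<le> \<epsilon> * (L * dist x y)"
      by (simp add: T dist_norm)
    also have "\<dots> = (\<epsilon> * L) * dist x y" by simp
    also have "\<dots> \<le> 1/2 * dist x y" using eL by (intro mult_right_mono) auto
    finally show "dist (T x s) (T y s) \<le> 1/2 * dist x y" .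
  qed
  then obtain u where u: "T u = u"
    using banach_fix_type[of "1/2" T] by auto
  have u_eq: "u s = x0 + I (\<lambda>s. F (u s)) s" if "s \<in> {-\<epsilon>..\<epsilon>}" for s
    using T[of u s] c_id[OF that] by (simp add: u)
  have u_in: "u s \<in> cball x0 r" if "s \<in> {-\<epsilon>..\<epsilon>}" for s
    using I_bound[OF continuous_on_apply_bcontfun that, of u] eK u_eq[OF that] by (simp add: dist_norm)
  have "u s \<in> cball x0 r \<and> (u has_vector_derivative f (u s)) (at s)" if s: "\<bar>s\<bar> < \<epsilon>" for s
  proof -
    have s': "s \<in> {-\<epsilon><..<\<epsilon>}" "s \<in> {-\<epsilon>..\<epsilon>}" using s by auto
    have "((\<lambda>s. x0 + I (\<lambda>s. F (u s)) s) has_vector_derivative 0 + F (u s)) (at s within {-\<epsilon>..\<epsilon>})"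
      by (intro has_vector_derivative_add has_vector_derivative_const I' s' Fx) auto
    then have "(u has_vector_derivative F (u s)) (at s within {-\<epsilon>..\<epsilon>})"
      using has_vector_derivative_transform[OF s'(2), of u] u_eq by simp
    then have "(u has_vector_derivative F (u s)) (at s)"
      using at_within_interior[of s "{-\<epsilon>..\<epsilon>}"] s'(1) by simp
    moreover have "F (u s) = f (u s)"
      using u_in[OF s'(2)] by (simp add: F_def closest_point_self)
    ultimately show ?thesis
      using u_in[OF s'(2)] by simp
  qed
  moreover have "u 0 = x0"
    using u_eq[of 0] e0 by (simp add: I0)
  ultimately show ?thesis
    using e0 by (intro that[of \<epsilon> u]) auto
qed

text \<open>On a short closed interval the distance of the two solutions attains a maximum; the mean
  value inequality bounds this maximum by half of itself, so it is 0.\<close>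

lemma ode_local_uniqueness:
  fixes u v :: "real \<Rightarrow> 'a::euclidean_space"
  assumes lip: "L-lipschitz_on S f"
    and u: "\<forall>\<^sub>F s in nhds s0. u s \<in> S \<and> (u has_vector_derivative f (u s)) (at s)"
    and v: "\<forall>\<^sub>F s in nhds s0. v s \<in> S \<and> (v has_vector_derivative f (v s)) (at s)"
    and eq: "u s0 = v s0"
  shows "\<forall>\<^sub>F s in nhds s0. u s = v s"
proof -
  have L0: "L \<ge> 0" using lip lipschitz_on_nonneg by blast
  obtain d where "d > 0" and d: "\<And>s. dist s s0 < d \<Longrightarrow>
      u s \<in> S \<and> (u has_vector_derivative f (u s)) (at s) \<and>
      v s \<in> S \<and> (v has_vector_derivative f (v s)) (at s)"
    using eventually_conj[OF u v] unfolding eventually_nhds_metric by auto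
  \<comment> \<open>\<open>d/2\<close> keeps the closed interval inside the region where both
    equations hold; the other bound gives \<open>L * e \<le> 1/2\<close>.\<close>
  define e where "e = min (d/2) (1 / (2 * (L + 1)))"
  let ?I = "cball s0 e" and ?w = "\<lambda>s. u s - v s"
  have e0: "e > 0" using \<open>d > 0\<close> L0 by (simp add: e_def)
  have eL: "L * e \<le> 1/2"
  proof -
    have "L * e \<le> L * (1 / (2 * (L + 1)))"
      by (rule mult_left_mono) (use L0 in \<open>auto simp: e_def\<close>)
    also have "\<dots> \<le> 1/2" using L0 by (simp add: field_simps)
    finally show ?thesis .
  qed
  have I: "dist s s0 < d" if "s \<in> ?I" for s
    using that \<open>d > 0\<close> e0 by (auto simp: e_def dist_commute min_def split: if_splits)
  have w': "(?w has_derivative (\<lambda>h. h *\<^sub>R (f (u s) - f (v s)))) (at s within ?I)" if "s \<in> ?I" for s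
    using has_vector_derivative_diff d[OF I[OF that]]
    by (metis has_vector_derivative_at_within has_vector_derivative_def)
  have "continuous_on ?I ?w"
    by (rule has_derivative_continuous_on[OF w'])
  then have "continuous_on ?I (\<lambda>s. norm (?w s))"
    by (rule continuous_on_norm)
  then obtain m where m: "m \<in> ?I" "\<And>s. s \<in> ?I \<Longrightarrow> norm (?w s) \<le> norm (?w m)"
    using continuous_attains_sup[of ?I "\<lambda>s. norm (?w s)"] e0
    by (auto simp del: mem_cball)
  have "norm (?w m - ?w s0) \<le> (L * norm (?w m)) * norm (m - s0)"
  proof (rule differentiable_bound[OF convex_cball w'])
    fix s assume s: "s \<in> ?I"
    have "norm (f (u s) - f (v s)) \<le> L * norm (?w s)"
      using lipschitz_onD[OF lip] d[OF I[OF s]] by (simp add: dist_norm)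
    also have "\<dots> \<le> L * norm (?w m)" by (intro mult_left_mono L0 m(2) s)
    finally show "onorm (\<lambda>h. h *\<^sub>R (f (u s) - f (v s))) \<le> L * norm (?w m)"
      by (intro onorm_le) (simp add: mult.commute[of "\<bar>_\<bar>"] mult_right_mono)
  qed (use m e0 in auto)
  also have "\<dots> \<le> (L * norm (?w m)) * e"
    using m(1) L0 by (intro mult_left_mono) (auto simp: dist_norm norm_minus_commute)
  also have "\<dots> = (L * e) * norm (?w m)" by simp
  also have "\<dots> \<le> 1/2 * norm (?w m)" using eL by (intro mult_right_mono) auto
  finally have "norm (?w m) \<le> 0" using eq by simp
  then have "u s = v s" if "dist s s0 < e" for s
    using m(2)[of s] that by (simp add: dist_commute)
  then show ?thesis
    using e0 unfolding eventually_nhds_metric by blast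
qed


section \<open>Derivatives in charts\<close>

text \<open>\<open>coord d\<close> is unconstrained outside \<open>dom_of d\<close>; the first
  clause is what lets \<open>param d\<close> undo \<open>coord d\<close> near the point. With
  \<open>(UNIV, id)\<close> as source or target chart, curves and real-valued functions are covered
  by the same notion.\<close>

definition has_local_derivative ::
  "('a, 'e::real_normed_vector) chart \<Rightarrow> ('b, 'f::real_normed_vector) chart \<Rightarrow> ('a \<Rightarrow> 'b) \<Rightarrow> 'a \<Rightarrow>
     ('e \<Rightarrow> 'f) \<Rightarrow> bool" where
  "has_local_derivative c d f q A \<longleftrightarrow>
     (\<forall>\<^sub>F y in nhds (coord c q). f (param c y) \<in> dom_of d) \<and>
     ((coord d \<circ> f \<circ> param c) has_derivative A) (at (coord c q))"

abbreviation prod_chart ::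
  "('a, 'e) chart \<Rightarrow> ('b, 'f) chart \<Rightarrow> ('a \<times> 'b, 'e \<times> 'f) chart" where
  "prod_chart c d \<equiv> (dom_of c \<times> dom_of d, map_prod (coord c) (coord d))"

section \<open>Charts as local homeomorphisms, and the calculus of derivatives in charts\<close>

lemma param_coord: "inj_on (coord c) (dom_of c) \<Longrightarrow> q \<in> dom_of c \<Longrightarrow> param c (coord c q) = q"
  by (simp add: param_def)

lemma is_chart_inj_on: "is_chart X c \<Longrightarrow> inj_on (coord c) (dom_of c)"
  by (auto simp: is_chart_def homeomorphic_map_def topspace_subtopology dest: openin_subset
      intro: inj_on_subset)

lemma is_chart_open_image:
  assumes c: "is_chart X c" and U: "openin X U"
  shows "open (coord c ` (dom_of c \<inter> U))"
proof -
  have "openin (subtopology X (dom_of c)) (dom_of c \<inter> U)"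
    using U openin_subtopology_Int2 by blast
  then have "openin (top_of_set (coord c ` dom_of c)) (coord c ` (dom_of c \<inter> U))"
    using c homeomorphic_imp_open_map unfolding is_chart_def open_map_def by blast
  then show ?thesis
    using c openin_open_trans unfolding is_chart_def by blast
qed

lemma is_chart_eventually:
  assumes c: "is_chart X c" and q: "q \<in> dom_of c" and U: "openin X U" "q \<in> U"
  shows "\<forall>\<^sub>F y in nhds (coord c q). param c y \<in> dom_of c \<inter> U \<and> coord c (param c y) = y"
proof -
  have "\<forall>\<^sub>F y in nhds (coord c q). y \<in> coord c ` (dom_of c \<inter> U)"
    using is_chart_open_image[OF c U(1)] q U(2) by (intro eventually_nhds_in_open) auto
  then show ?thesis
    by eventually_elim (use param_coord[OF is_chart_inj_on[OF c]] in auto)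
qed

lemma is_chart_eventually_dom:
  assumes "is_chart X c" "q \<in> dom_of c"
  shows "\<forall>\<^sub>F y in nhds (coord c q). param c y \<in> dom_of c \<and> coord c (param c y) = y"
  using is_chart_eventually[OF assms, of "dom_of c"] assms by (simp add: is_chart_def)

lemma is_chart_prod:
  assumes c: "is_chart X c" and d: "is_chart Y d"
  shows "is_chart (prod_topology X Y) (prod_chart c d)"
proof -
  obtain c' d' where
    "homeomorphic_maps (subtopology X (dom_of c)) (top_of_set (coord c ` dom_of c)) (coord c) c'"
    "homeomorphic_maps (subtopology Y (dom_of d)) (top_of_set (coord d ` dom_of d)) (coord d) d'"
    using c d unfolding is_chart_def homeomorphic_map_maps by blast
  then have "homeomorphic_maps
      (prod_topology (subtopology X (dom_of c)) (subtopology Y (dom_of d)))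
      (prod_topology (top_of_set (coord c ` dom_of c)) (top_of_set (coord d ` dom_of d)))
      (\<lambda>(x, y). (coord c x, coord d y)) (\<lambda>(x, y). (c' x, d' y))"
    by (subst homeomorphic_maps_prod) simp
  then have "homeomorphic_map
      (subtopology (prod_topology X Y) (dom_of c \<times> dom_of d))
      (top_of_set (coord c ` dom_of c \<times> coord d ` dom_of d)) (map_prod (coord c) (coord d))"
    unfolding homeomorphic_map_maps map_prod_def by (auto simp: subtopology_Times)
  moreover have "map_prod (coord c) (coord d) ` (dom_of c \<times> dom_of d) =
      coord c ` dom_of c \<times> coord d ` dom_of d"
    by force
  ultimately show ?thesis
    using c d by (simp add: is_chart_def openin_prod_Times_iff open_Times)
qed

text \<open>\<open>param d\<close> and \<open>coord d\<close> cancel only near the point, so the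
  Euclidean chain rule is applied to the two coordinate representations and then transferred on an
  open set where their composite represents the composite map.\<close>

lemma has_local_derivative_compose:
  assumes c: "inj_on (coord c) (dom_of c)" "q \<in> dom_of c" and d: "inj_on (coord d) (dom_of d)"
    and f: "has_local_derivative c d f q A" and g: "has_local_derivative d e g (f q) B"
  shows "has_local_derivative c e (\<lambda>x. g (f x)) q (\<lambda>v. B (A v))"
proof -
  let ?f = "coord d \<circ> f \<circ> param c" and ?g = "coord e \<circ> g \<circ> param d"
  have fq: "?f (coord c q) = coord d (f q)"
    by (simp add: param_coord[OF c])
  have f1: "\<forall>\<^sub>F y in nhds (coord c q). f (param c y) \<in> dom_of d"
    and f2: "(?f has_derivative A) (at (coord c q))"
    and g1: "\<forall>\<^sub>F y in nhds (?f (coord c q)). g (param d y) \<in> dom_of e"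
    and g2: "(?g has_derivative B) (at (?f (coord c q)))"
    using f g fq by (auto simp: has_local_derivative_def)
  \<comment> \<open>Continuity of the coordinate form of \<open>f\<close> pulls the neighbourhood
    condition on \<open>g\<close> back to \<open>q\<close>.\<close>
  have "isCont ?f (coord c q)"
    using f2 has_derivative_continuous by blast
  then have "filterlim ?f (nhds (?f (coord c q))) (nhds (coord c q))"
    by (simp only: isCont_def tendsto_at_iff_tendsto_nhds)
  then have "\<forall>\<^sub>F y in nhds (coord c q). g (param d (?f y)) \<in> dom_of e"
    using eventually_compose_filterlim[OF g1] by blast
  with f1 have 1: "\<forall>\<^sub>F y in nhds (coord c q). g (f (param c y)) \<in> dom_of e"
    by eventually_elim (simp add: param_coord[OF d])
  have 2: "((?g \<circ> ?f) has_derivative (B \<circ> A)) (at (coord c q))"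
    using diff_chain_at[OF f2 g2] .
  have "\<forall>\<^sub>F y in nhds (coord c q). (?g \<circ> ?f) y = (coord e \<circ> (\<lambda>x. g (f x)) \<circ> param c) y"
    using f1 by eventually_elim (simp add: param_coord[OF d])
  then obtain S where S: "open S" "coord c q \<in> S"
      "\<And>y. y \<in> S \<Longrightarrow> (?g \<circ> ?f) y = (coord e \<circ> (\<lambda>x. g (f x)) \<circ> param c) y"
    unfolding eventually_nhds by blast
  have "((coord e \<circ> (\<lambda>x. g (f x)) \<circ> param c) has_derivative (B \<circ> A)) (at (coord c q))"
    by (rule has_derivative_transform_within_open[OF 2 S])
  with 1 show ?thesis
    unfolding has_local_derivative_def comp_def by blast
qed

lemma has_local_derivative_transform:
  assumes f: "has_local_derivative c d f q A"
    and eq: "\<forall>\<^sub>F y in nhds (coord c q). f (param c y) = g (param c y)"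
  shows "has_local_derivative c d g q A"
proof -
  have 1: "\<forall>\<^sub>F y in nhds (coord c q). g (param c y) \<in> dom_of d"
    using eventually_conj[OF eq conjunct1[OF f[unfolded has_local_derivative_def]]]
    by eventually_elim auto
  obtain S where S: "open S" "coord c q \<in> S"
      "\<And>y. y \<in> S \<Longrightarrow> f (param c y) = g (param c y)"
    using eq unfolding eventually_nhds by blast
  have "((coord d \<circ> g \<circ> param c) has_derivative A) (at (coord c q))"
    by (rule has_derivative_transform_within_open[OF conjunct2[OF f[unfolded has_local_derivative_def]] S(1,2)])
      (simp add: S(3))
  with 1 show ?thesis
    by (simp add: has_local_derivative_def)
qed

lemma has_local_derivative_Pair:
  assumes "has_local_derivative c d f q A" "has_local_derivative c e g q B"
  shows "has_local_derivative c (prod_chart d e) (\<lambda>x. (f x, g x)) q (\<lambda>v. (A v, B v))"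
  using assms by (auto simp: has_local_derivative_def comp_def eventually_conj_iff intro: has_derivative_Pair)

lemma has_local_derivative_const:
  "z \<in> dom_of d \<Longrightarrow> has_local_derivative c d (\<lambda>_. z) q (\<lambda>_. 0)"
  by (simp add: has_local_derivative_def comp_def)

lemma has_local_derivative_ident:
  assumes "is_chart X c" "q \<in> dom_of c"
  shows "has_local_derivative c c (\<lambda>x. x) q (\<lambda>v. v)"
proof -
  obtain S where S: "open S" "coord c q \<in> S"
      "\<And>y. y \<in> S \<Longrightarrow> param c y \<in> dom_of c \<and> coord c (param c y) = y"
    using is_chart_eventually_dom[OF assms] unfolding eventually_nhds by blast
  have "((coord c \<circ> (\<lambda>x. x) \<circ> param c) has_derivative (\<lambda>v. v)) (at (coord c q))"
    by (rule has_derivative_transform_within_open[OF has_derivative_ident S(1,2)]) (simp add: S(3))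
  then show ?thesis
    unfolding has_local_derivative_def eventually_nhds using S by blast
qed

lemma has_local_derivative_fst:
  assumes c: "is_chart X c" "x \<in> dom_of c" and d: "is_chart Y d" "y \<in> dom_of d"
  shows "has_local_derivative (prod_chart c d) c fst (x, y) fst"
proof -
  let ?C = "prod_chart c d"
  have "\<forall>\<^sub>F z in nhds (coord ?C (x, y)). param ?C z \<in> dom_of ?C \<and> coord ?C (param ?C z) = z"
    by (rule is_chart_eventually_dom[OF is_chart_prod[OF c(1) d(1)]]) (use c d in auto)
  then have "\<forall>\<^sub>F z in nhds (coord ?C (x, y)).
      fst (param ?C z) \<in> dom_of c \<and> fst z = (coord c \<circ> fst \<circ> param ?C) z"
  proof eventually_elim
    case (elim z)
    then show ?case by (cases "param ?C z") auto
  qed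
  then obtain S where S: "open S" "coord ?C (x, y) \<in> S"
      "\<And>z. z \<in> S \<Longrightarrow> fst (param ?C z) \<in> dom_of c \<and> fst z = (coord c \<circ> fst \<circ> param ?C) z"
    unfolding eventually_nhds by blast
  have "((coord c \<circ> fst \<circ> param ?C) has_derivative fst) (at (coord ?C (x, y)))"
    by (rule has_derivative_transform_within_open
        [OF bounded_linear_imp_has_derivative[OF bounded_linear_fst] S(1,2)]) (use S(3) in blast)
  then show ?thesis
    unfolding has_local_derivative_def eventually_nhds using S by blast
qed

lemma has_local_derivative_snd:
  assumes c: "is_chart X c" "x \<in> dom_of c" and d: "is_chart Y d" "y \<in> dom_of d"
  shows "has_local_derivative (prod_chart c d) d snd (x, y) snd"
proof -
  let ?C = "prod_chart c d"
  have "\<forall>\<^sub>F z in nhds (coord ?C (x, y)). param ?C z \<in> dom_of ?C \<and> coord ?C (param ?C z) = z"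
    by (rule is_chart_eventually_dom[OF is_chart_prod[OF c(1) d(1)]]) (use c d in auto)
  then have "\<forall>\<^sub>F z in nhds (coord ?C (x, y)).
      snd (param ?C z) \<in> dom_of d \<and> snd z = (coord d \<circ> snd \<circ> param ?C) z"
  proof eventually_elim
    case (elim z)
    then show ?case by (cases "param ?C z") auto
  qed
  then obtain S where S: "open S" "coord ?C (x, y) \<in> S"
      "\<And>z. z \<in> S \<Longrightarrow> snd (param ?C z) \<in> dom_of d \<and> snd z = (coord d \<circ> snd \<circ> param ?C) z"
    unfolding eventually_nhds by blast
  have "((coord d \<circ> snd \<circ> param ?C) has_derivative snd) (at (coord ?C (x, y)))"
    by (rule has_derivative_transform_within_open
        [OF bounded_linear_imp_has_derivative[OF bounded_linear_snd] S(1,2)]) (use S(3) in blast)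
  then show ?thesis
    unfolding has_local_derivative_def eventually_nhds using S by blast
qed

lemma has_local_derivative_frechet:
  "has_local_derivative c d f q A \<Longrightarrow>
     frechet_derivative (coord d \<circ> f \<circ> param c) (at (coord c q)) = A"
  unfolding has_local_derivative_def by (rule frechet_derivative_at[symmetric]) simp

lemma has_local_derivative_linear: "has_local_derivative c d f q A \<Longrightarrow> linear A"
  unfolding has_local_derivative_def using has_derivative_linear by blast

lemma has_local_derivative_unique:
  "has_local_derivative c d f q A \<Longrightarrow> has_local_derivative c d f q B \<Longrightarrow> A = B"
  using has_local_derivative_frechet[of c d f q A] has_local_derivative_frechet[of c d f q B] by simp

text \<open>The topological facts about charts, isolated because they pass directly to products,
  where the arguments stay in one product chart.\<close>

definition manifold_charts :: "('a, 'e::euclidean_space) mfd \<Rightarrow> bool" where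
  "manifold_charts M \<longleftrightarrow>
     (\<forall>c\<in>atlas M. is_chart (mfd_top M) c) \<and> (\<Union>c\<in>atlas M. dom_of c) = points M"

lemma smooth_manifold_charts: "smooth_manifold M \<Longrightarrow> manifold_charts M"
  by (simp add: smooth_manifold_def manifold_charts_def)

lemma manifold_chartsD:
  assumes "manifold_charts M" "c \<in> charts_at M q"
  shows "is_chart (mfd_top M) c" "inj_on (coord c) (dom_of c)" "q \<in> dom_of c" "q \<in> points M"
  using assms is_chart_inj_on[of "mfd_top M" c] by (auto simp: manifold_charts_def charts_at_def)

lemma manifold_charts_nonempty:
  "manifold_charts M \<Longrightarrow> q \<in> points M \<Longrightarrow> charts_at M q \<noteq> {}"
  unfolding manifold_charts_def charts_at_def by blast

lemma chart_at_in: "manifold_charts M \<Longrightarrow> q \<in> points M \<Longrightarrow> chart_at M q \<in> charts_at M q"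
  unfolding chart_at_def using manifold_charts_nonempty some_in_eq by fastforce

section \<open>Product atlases and Euclidean charts\<close>

lemma atlas_prod:
  "atlas (prod_mfd M N) = {prod_chart c d | c d. c \<in> atlas M \<and> d \<in> atlas N}"
  by (simp add: prod_mfd_def)

lemma charts_at_prod:
  "charts_at (prod_mfd M N) (x, y) =
     {prod_chart c d | c d. c \<in> charts_at M x \<and> d \<in> charts_at N y}"
proof (intro equalityI subsetI)
  fix C assume C: "C \<in> charts_at (prod_mfd M N) (x, y)"
  then obtain c d where cd: "C = prod_chart c d" "c \<in> atlas M" "d \<in> atlas N"
    unfolding charts_at_def atlas_prod by blast
  then have "c \<in> charts_at M x \<and> d \<in> charts_at N y"
    using C by (simp add: charts_at_def)
  with cd(1) show "C \<in> {prod_chart c d | c d. c \<in> charts_at M x \<and> d \<in> charts_at N y}"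
    by blast
next
  fix C assume "C \<in> {prod_chart c d | c d. c \<in> charts_at M x \<and> d \<in> charts_at N y}"
  then obtain c d where cd: "C = prod_chart c d" "c \<in> charts_at M x" "d \<in> charts_at N y"
    by blast
  then have "C \<in> atlas (prod_mfd M N)"
    unfolding charts_at_def atlas_prod by blast
  with cd show "C \<in> charts_at (prod_mfd M N) (x, y)"
    by (simp add: charts_at_def)
qed

lemma mfd_top_prod: "mfd_top (prod_mfd M N) = prod_topology (mfd_top M) (mfd_top N)"
  by (simp add: prod_mfd_def)

lemma points_prod: "points (prod_mfd M N) = points M \<times> points N"
  by (simp add: prod_mfd_def)

lemma manifold_charts_prod:
  assumes "manifold_charts M" "manifold_charts N"
  shows "manifold_charts (prod_mfd M N)"
proof -
  have "(\<Union>c\<in>atlas (prod_mfd M N). dom_of c) = (\<Union>c\<in>atlas M. dom_of c) \<times> (\<Union>d\<in>atlas N. dom_of d)"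
  proof (intro equalityI subsetI)
    fix z assume "z \<in> (\<Union>c\<in>atlas M. dom_of c) \<times> (\<Union>d\<in>atlas N. dom_of d)"
    then obtain c d where cd: "c \<in> atlas M" "d \<in> atlas N" "z \<in> dom_of (prod_chart c d)"
      by auto
    then have "prod_chart c d \<in> atlas (prod_mfd M N)"
      unfolding atlas_prod by blast
    with cd(3) show "z \<in> (\<Union>c\<in>atlas (prod_mfd M N). dom_of c)" by blast
  qed (auto simp: prod_mfd_def)
  moreover have "is_chart (mfd_top (prod_mfd M N)) C" if C: "C \<in> atlas (prod_mfd M N)" for C
  proof -
    obtain c d where "C = prod_chart c d" "c \<in> atlas M" "d \<in> atlas N"
      using C unfolding atlas_prod by blast
    then show ?thesis
      using assms is_chart_prod[of "mfd_top M" c "mfd_top N" d]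
      by (simp add: manifold_charts_def mfd_top_prod)
  qed
  ultimately show ?thesis
    using assms by (simp add: manifold_charts_def points_prod)
qed

lemma charts_at_euclidean: "charts_at euclidean_mfd x = {(UNIV, id)}"
  by (auto simp: charts_at_def euclidean_mfd_def)

lemma param_id: "param (UNIV, id) = id"
  by (simp add: param_def)

lemma is_chart_euclidean: "is_chart euclidean (UNIV, id :: 'e::euclidean_space \<Rightarrow> 'e)"
  by (simp add: is_chart_def)

lemma manifold_charts_euclidean: "manifold_charts euclidean_mfd"
  by (simp add: manifold_charts_def euclidean_mfd_def is_chart_euclidean)

text \<open>Continuity of \<open>f\<close> makes the preimage of a chart domain open.
  \<open>Cr_map\<close> imposes its condition on exactly this set, and openness gives each of its
  points a full neighbourhood that \<open>f\<close> sends into the target chart.\<close>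

lemma Cr_map_local_domain_open:
  assumes f: "Cr_map r M N f" and M: "manifold_charts M" and N: "manifold_charts N"
    and c: "c \<in> atlas M" and d: "d \<in> atlas N"
  shows "open (coord c ` (dom_of c \<inter> f -` dom_of d))"
proof -
  let ?U = "{x \<in> points M. f x \<in> dom_of d}"
  have "openin (mfd_top N) (dom_of d)" and cc: "is_chart (mfd_top M) c"
    using M N c d by (auto simp: manifold_charts_def is_chart_def)
  then have "openin (mfd_top M) ?U"
    using f openin_continuous_map_preimage unfolding Cr_map_def by blast
  moreover have "dom_of c \<inter> f -` dom_of d = dom_of c \<inter> ?U"
    using M c by (auto simp: manifold_charts_def)
  ultimately show ?thesis
    using is_chart_open_image[OF cc] by metis
qed

text \<open>The passage from a global regularity condition to a derivative at a point, used alike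
  for multiplication, the action, the Lagrangian and coordinate changes.\<close>

lemma Cr_map_has_local_derivative:
  assumes f: "Cr_map r M N f" "1 \<le> r" and M: "manifold_charts M" and N: "manifold_charts N"
    and c: "c \<in> charts_at M q" and d: "d \<in> charts_at N (f q)"
  shows "has_local_derivative c d f q
           (frechet_derivative (coord d \<circ> f \<circ> param c) (at (coord c q)))"
proof -
  let ?S = "coord c ` (dom_of c \<inter> f -` dom_of d)"
  have cd: "c \<in> atlas M" "d \<in> atlas N" "q \<in> dom_of c" "f q \<in> dom_of d"
    using c d by (auto simp: charts_at_def)
  have S: "open ?S" "coord c q \<in> ?S"
    using Cr_map_local_domain_open[OF f(1) M N cd(1,2)] cd by auto
  have "Cr_on r ?S (coord d \<circ> f \<circ> param c)"
    using f cd unfolding Cr_map_def by blast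
  then have "times_differentiable_on (Suc 0) ?S (coord d \<circ> f \<circ> param c)"
    using f(2) unfolding Cr_on_def one_enat_def One_nat_def by blast
  then have "(coord d \<circ> f \<circ> param c) differentiable (at (coord c q))"
    using S unfolding times_differentiable_on.simps by blast
  moreover have "\<forall>\<^sub>F y in nhds (coord c q). f (param c y) \<in> dom_of d"
    using eventually_nhds_in_open[OF S]
    by eventually_elim (use param_coord[OF manifold_chartsD(2)[OF M c]] in auto)
  ultimately show ?thesis
    by (simp add: has_local_derivative_def frechet_derivative_works)
qed

lemma transition_has_local_derivative:
  assumes M: "smooth_manifold M" and c: "c \<in> charts_at M q" and d: "d \<in> charts_at M q"
  shows "has_local_derivative c d (\<lambda>x. x) q
           (frechet_derivative (coord d \<circ> param c) (at (coord c q)))"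
proof -
  \<comment> \<open>Compatibility of the atlas is smoothness of the identity map, so a coordinate
    change is the derivative of the identity between two charts.\<close>
  have "Cr_map \<infinity> M M (\<lambda>x. x)"
    using M by (auto simp: Cr_map_def smooth_manifold_def comp_def)
  then have "has_local_derivative c d (\<lambda>x. x) q
      (frechet_derivative (coord d \<circ> (\<lambda>x. x) \<circ> param c) (at (coord c q)))"
    by (rule Cr_map_has_local_derivative) (use smooth_manifold_charts[OF M] c d in auto)
  then show ?thesis by (simp add: comp_def)
qed

lemma tangent_spaceI:
  assumes "\<And>c. c \<notin> charts_at M q \<Longrightarrow> v c = 0"
    and "\<And>c d A. \<lbrakk>c \<in> charts_at M q; d \<in> charts_at M q; has_local_derivative c d (\<lambda>x. x) q A\<rbrakk>
           \<Longrightarrow> v d = A (v c)"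
    and "smooth_manifold M"
  shows "v \<in> tangent_space M q"
  using assms(1,2) transition_has_local_derivative[OF assms(3)] by (simp add: tangent_space_def)


section \<open>Velocities of curves\<close>

text \<open>\<open>velocity\<close> has a value even for curves without a derivative. This relation
  also asserts differentiability, and it constrains \<open>v\<close> only in the charts around
  \<open>\<gamma> s\<close>.\<close>

definition has_velocity ::
  "('a, 'e::euclidean_space) mfd \<Rightarrow> (real \<Rightarrow> 'a) \<Rightarrow> real \<Rightarrow> ('a, 'e) tvec \<Rightarrow> bool" where
  "has_velocity M \<gamma> s v \<longleftrightarrow>
     \<gamma> s \<in> points M \<and>
     (\<forall>d\<in>charts_at M (\<gamma> s). has_local_derivative (UNIV, id) d \<gamma> s (\<lambda>h. h *\<^sub>R v d))"

lemma has_local_derivative_curve: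
  "has_local_derivative (UNIV, id) d \<gamma> s A \<longleftrightarrow>
     (\<forall>\<^sub>F s' in nhds s. \<gamma> s' \<in> dom_of d) \<and> ((coord d \<circ> \<gamma>) has_derivative A) (at s)"
  by (simp add: has_local_derivative_def param_id)

lemma has_velocity_curve:
  assumes "has_velocity M \<gamma> s v" "d \<in> charts_at M (\<gamma> s)"
  shows "\<forall>\<^sub>F s' in nhds s. \<gamma> s' \<in> dom_of d" "((coord d \<circ> \<gamma>) has_vector_derivative v d) (at s)"
  using assms by (auto simp: has_velocity_def has_local_derivative_curve has_vector_derivative_def)

lemma has_velocity_imp_velocity:
  "has_velocity M \<gamma> s v \<Longrightarrow> d \<in> charts_at M (\<gamma> s) \<Longrightarrow> velocity M \<gamma> s d = v d"
  using has_velocity_curve(2) vector_derivative_at by (fastforce simp: velocity_def)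

text \<open>The chain rule with coordinate changes carries a velocity known in one chart to all the
  others.\<close>

lemma has_velocity_chartI:
  assumes M: "smooth_manifold M" and c: "c \<in> charts_at M (\<gamma> s)"
    and \<gamma>: "has_local_derivative (UNIV, id) c \<gamma> s (\<lambda>h. h *\<^sub>R v c)"
    and v: "\<And>d A. \<lbrakk>d \<in> charts_at M (\<gamma> s); has_local_derivative c d (\<lambda>x. x) (\<gamma> s) A\<rbrakk> \<Longrightarrow> v d = A (v c)"
  shows "has_velocity M \<gamma> s v"
  unfolding has_velocity_def
proof (intro conjI ballI)
  note mc = smooth_manifold_charts[OF M]
  show "\<gamma> s \<in> points M" using manifold_chartsD(4)[OF mc c] .
  fix d assume d: "d \<in> charts_at M (\<gamma> s)"
  obtain A where A: "has_local_derivative c d (\<lambda>x. x) (\<gamma> s) A"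
    using transition_has_local_derivative[OF M c d] by blast
  have "has_local_derivative (UNIV, id) d \<gamma> s (\<lambda>h. A (h *\<^sub>R v c))"
    by (rule has_local_derivative_compose[OF _ _ manifold_chartsD(2)[OF mc c] \<gamma> A]) auto
  then show "has_local_derivative (UNIV, id) d \<gamma> s (\<lambda>h. h *\<^sub>R v d)"
    using v[OF d A] linear_cmul[OF has_local_derivative_linear[OF A]] by simp
qed

text \<open>\<open>w\<close> is prescribed chart by chart, with a freely chosen source chart for
  each target chart, so its compatibility between charts need not be checked.\<close>

lemma has_velocity_compose:
  assumes M: "manifold_charts M" and \<gamma>: "has_velocity M \<gamma> s v" and f: "f (\<gamma> s) \<in> points N"
    and fw: "\<And>d. d \<in> charts_at N (f (\<gamma> s)) \<Longrightarrow>
           \<exists>c\<in>charts_at M (\<gamma> s). \<exists>A. has_local_derivative c d f (\<gamma> s) A \<and> w d = A (v c)"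
  shows "has_velocity N (\<lambda>s. f (\<gamma> s)) s w"
  unfolding has_velocity_def
proof (intro conjI ballI f)
  fix d assume "d \<in> charts_at N (f (\<gamma> s))"
  then obtain c A where c: "c \<in> charts_at M (\<gamma> s)"
    and A: "has_local_derivative c d f (\<gamma> s) A" "w d = A (v c)"
    using fw by blast
  have g: "has_local_derivative (UNIV, id) c \<gamma> s (\<lambda>h. h *\<^sub>R v c)"
    using \<gamma> c by (simp add: has_velocity_def)
  have "has_local_derivative (UNIV, id) d (\<lambda>s. f (\<gamma> s)) s (\<lambda>h. A (h *\<^sub>R v c))"
    by (rule has_local_derivative_compose[OF _ _ manifold_chartsD(2)[OF M c] g A(1)]) auto
  then show "has_local_derivative (UNIV, id) d (\<lambda>s. f (\<gamma> s)) s (\<lambda>h. h *\<^sub>R w d)"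
    using A(2) linear_cmul[OF has_local_derivative_linear[OF A(1)]] by simp
qed

lemma has_velocity_transform:
  assumes \<gamma>: "has_velocity M \<gamma> s v" and eq: "\<forall>\<^sub>F s' in nhds s. \<gamma> s' = \<delta> s'"
  shows "has_velocity M \<delta> s v"
proof -
  have "\<gamma> s = \<delta> s" using eventually_nhds_x_imp_x[OF eq] .
  then show ?thesis
    using \<gamma> has_local_derivative_transform[of "(UNIV, id)" _ \<gamma> s _ \<delta>] eq
    unfolding has_velocity_def param_id by auto
qed

text \<open>Needed for \<open>a = 1\<close>, to shift local pieces in time before gluing, and for
  \<open>b = 0\<close>, to rescale time in the exponential.\<close>

lemma has_velocity_affine:
  assumes "has_velocity M \<gamma> (a * s + b) v"
  shows "has_velocity M (\<lambda>s. \<gamma> (a * s + b)) s (\<lambda>d. a *\<^sub>R v d)"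
  unfolding has_velocity_def
proof (intro conjI ballI)
  show "\<gamma> (a * s + b) \<in> points M" using assms by (simp add: has_velocity_def)
  fix d assume "d \<in> charts_at M (\<gamma> (a * s + b))"
  then have g: "has_local_derivative (UNIV, id) d \<gamma> (a * s + b) (\<lambda>h. h *\<^sub>R v d)"
    using assms by (simp add: has_velocity_def)
  have "((\<lambda>s. a * s + b) has_derivative (\<lambda>h. a * h)) (at s)"
    by (auto intro!: derivative_eq_intros)
  then have "has_local_derivative (UNIV, id) (UNIV, id) (\<lambda>s. a * s + b) s (\<lambda>h. a * h)"
    by (simp add: has_local_derivative_curve)
  from has_local_derivative_compose[OF _ _ _ this g]
  show "has_local_derivative (UNIV, id) d (\<lambda>s. \<gamma> (a * s + b)) s (\<lambda>h. h *\<^sub>R a *\<^sub>R v d)"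
    by (simp add: mult.commute)
qed

text \<open>A velocity only gives continuity of the coordinate curve. The chart sends
  \<open>U\<close> to an open set, and its injectivity brings membership back to \<open>U\<close>
  while the curve stays in the chart domain.\<close>

lemma has_velocity_eventually:
  assumes M: "manifold_charts M" and \<gamma>: "has_velocity M \<gamma> s v"
    and U: "openin (mfd_top M) U" "\<gamma> s \<in> U"
  shows "\<forall>\<^sub>F s' in nhds s. \<gamma> s' \<in> U"
proof -
  obtain d where d: "d \<in> charts_at M (\<gamma> s)"
    using \<gamma> chart_at_in[OF M] unfolding has_velocity_def by blast
  note v = has_velocity_curve[OF \<gamma> d] and dd = manifold_chartsD[OF M d]
  have "isCont (coord d \<circ> \<gamma>) s"
    using v(2) has_vector_derivative_continuous by blast
  then have "filterlim (coord d \<circ> \<gamma>) (nhds ((coord d \<circ> \<gamma>) s)) (nhds s)"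
    by (simp only: isCont_def tendsto_at_iff_tendsto_nhds)
  moreover have "\<forall>\<^sub>F y in nhds ((coord d \<circ> \<gamma>) s). y \<in> coord d ` (dom_of d \<inter> U)"
    using is_chart_open_image[OF dd(1) U(1)] dd(3) U(2) by (intro eventually_nhds_in_open) auto
  ultimately have "\<forall>\<^sub>F s' in nhds s. (coord d \<circ> \<gamma>) s' \<in> coord d ` (dom_of d \<inter> U)"
    using eventually_compose_filterlim by blast
  with v(1) show ?thesis
    by eventually_elim (use dd(2) in \<open>auto dest: inj_onD\<close>)
qed

text \<open>\<open>integral_curve\<close> compares whole chart-indexed families, so \<open>X\<close>
  has to share the default value 0 of \<open>velocity\<close> off the charts. Conversely, continuity
  of the curve follows from its having a velocity at each time.\<close>

lemma integral_curve_iff_has_velocity: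
  assumes M: "manifold_charts M"
    and X: "\<And>q d. q \<in> points M \<Longrightarrow> d \<notin> charts_at M q \<Longrightarrow> X q d = 0"
  shows "integral_curve M X \<gamma> \<longleftrightarrow> (\<forall>s. has_velocity M \<gamma> s (X (\<gamma> s)))"
proof
  assume \<gamma>: "integral_curve M X \<gamma>"
  have cont: "continuous_map euclidean (mfd_top M) \<gamma>"
    using \<gamma> by (simp add: integral_curve_def differentiable_curve_def)
  show "\<forall>s. has_velocity M \<gamma> s (X (\<gamma> s))"
    unfolding has_velocity_def has_local_derivative_curve
  proof (intro allI conjI ballI)
    fix s
    show "\<gamma> s \<in> points M"
      using continuous_map_image_subset_topspace[OF cont] by auto
    fix d assume d: "d \<in> charts_at M (\<gamma> s)"
    have "openin (mfd_top M) (dom_of d)"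
      using manifold_chartsD(1)[OF M d] by (simp add: is_chart_def)
    then have "open {s. \<gamma> s \<in> dom_of d}"
      using openin_continuous_map_preimage[OF cont] by fastforce
    then show "\<forall>\<^sub>F s in nhds s. \<gamma> s \<in> dom_of d"
      using eventually_nhds_in_open manifold_chartsD(3)[OF M d] by fastforce
    have "(coord d \<circ> \<gamma>) differentiable (at s)"
      using \<gamma> d by (simp add: integral_curve_def differentiable_curve_def)
    then have "((coord d \<circ> \<gamma>) has_vector_derivative velocity M \<gamma> s d) (at s)"
      using d by (simp add: velocity_def vector_derivative_works)
    then show "(coord d \<circ> \<gamma> has_derivative (\<lambda>h. h *\<^sub>R X (\<gamma> s) d)) (at s)"
      using \<gamma> by (simp add: integral_curve_def has_vector_derivative_def)
  qed
next
  assume \<gamma>: "\<forall>s. has_velocity M \<gamma> s (X (\<gamma> s))"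
  have "continuous_map euclidean (mfd_top M) \<gamma>"
    unfolding continuous_map_def
  proof (intro conjI allI impI)
    show "\<gamma> \<in> topspace euclidean \<rightarrow> points M"
      using \<gamma> by (simp add: has_velocity_def)
    fix U assume U: "openin (mfd_top M) U"
    have "open {s. \<gamma> s \<in> U}"
      by (subst open_subopen)
        (use has_velocity_eventually[OF M] \<gamma> U in \<open>fastforce simp: eventually_nhds\<close>)
    then show "openin euclidean {x \<in> topspace euclidean. \<gamma> x \<in> U}" by simp
  qed
  moreover have "velocity M \<gamma> s = X (\<gamma> s)" for s
  proof
    fix d
    show "velocity M \<gamma> s d = X (\<gamma> s) d"
      using has_velocity_imp_velocity[of M \<gamma> s "X (\<gamma> s)" d] \<gamma> X[of "\<gamma> s" d]
      by (cases "d \<in> charts_at M (\<gamma> s)") (auto simp: velocity_def has_velocity_def)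
  qed
  ultimately show "integral_curve M X \<gamma>"
    using \<gamma> has_velocity_curve(2) vector_derivative_works
    unfolding integral_curve_def differentiable_curve_def
    by (metis differentiableI_vector)
qed


section \<open>The exponential map of a Lie group\<close>

locale lie_grp =
  fixes G :: "'g monoid" (structure) and M :: "('g, 'e::euclidean_space) mfd"
  assumes lie: "lie_group G M"

sublocale lie_grp \<subseteq> group G
  using lie by (simp add: lie_group_def)

context lie_grp
begin

lemma smooth: "smooth_manifold M" and points: "points M = carrier G"
  and smooth_mult: "smooth_map (prod_mfd M M) M (\<lambda>(g, h). g \<otimes> h)"
  using lie by (auto simp: lie_group_def)

lemmas charts = smooth_manifold_charts[OF smooth]

text \<open>The chart that \<open>tangent_map\<close> selects at the identity: a left-invariant
  field depends on \<open>\<xi>\<close> only through this component.\<close>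

abbreviation chart1 :: "('g, 'e) chart" where "chart1 \<equiv> chart_at M \<one>"

lemma chart1: "chart1 \<in> charts_at M \<one>"
  by (rule chart_at_in[OF charts]) (simp add: points)

lemma chart_dom_carrier: "c \<in> charts_at M q \<Longrightarrow> x \<in> dom_of c \<Longrightarrow> x \<in> carrier G"
  using charts points by (auto simp: charts_at_def manifold_charts_def)

text \<open>Left translation is the multiplication restricted to a slice. Writing its derivative as
  a partial derivative of the joint map exhibits how it varies with \<open>g\<close>, which the
  Lipschitz estimate for the field requires.\<close>

lemma left_mult_has_local_derivative:
  assumes e: "e \<in> charts_at M g" and c: "c \<in> charts_at M h" and d: "d \<in> charts_at M (g \<otimes> h)"
  shows "has_local_derivative c d (\<lambda>x. g \<otimes> x) h
           (\<lambda>v. frechet_derivative (coord d \<circ> (\<lambda>(g, h). g \<otimes> h) \<circ> param (prod_chart e c))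
                  (at (coord (prod_chart e c) (g, h))) (0, v))"
proof -
  have ec: "prod_chart e c \<in> charts_at (prod_mfd M M) (g, h)"
    using e c unfolding charts_at_prod by blast
  let ?D = "frechet_derivative (coord d \<circ> (\<lambda>(g, h). g \<otimes> h) \<circ> param (prod_chart e c))
      (at (coord (prod_chart e c) (g, h)))"
  note ee = manifold_chartsD[OF charts e] and cc = manifold_chartsD[OF charts c]
    and pc = manifold_charts_prod[OF charts charts]
  have D: "has_local_derivative (prod_chart e c) d (\<lambda>(g, h). g \<otimes> h) (g, h) ?D"
    by (rule Cr_map_has_local_derivative[OF smooth_mult _ pc charts ec]) (use d in auto)
  have P: "has_local_derivative c (prod_chart e c) (\<lambda>x. (g, x)) h (\<lambda>v. (0, v))"
    by (rule has_local_derivative_Pair[OF has_local_derivative_const[OF ee(3)]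
          has_local_derivative_ident[OF cc(1,3)]])
  from has_local_derivative_compose[OF cc(2,3) manifold_chartsD(2)[OF pc ec] P D]
  show ?thesis by simp
qed

lemma left_mult_local_derivative_exists:
  assumes "g \<in> carrier G" "c \<in> charts_at M h" "d \<in> charts_at M (g \<otimes> h)"
  obtains A where "has_local_derivative c d (\<lambda>x. g \<otimes> x) h A"
proof -
  have "chart_at M g \<in> charts_at M g"
    using chart_at_in[OF charts] assms(1) points by simp
  from left_mult_has_local_derivative[OF this assms(2,3)] that show ?thesis by blast
qed

section \<open>Left-invariant vector fields\<close>

abbreviation field :: "('g, 'e) tvec \<Rightarrow> 'g \<Rightarrow> ('g, 'e) tvec" where
  "field \<equiv> left_invariant_field G M"

lemma field_eq:
  assumes "g \<in> carrier G" "d \<in> charts_at M g" "has_local_derivative chart1 d (\<lambda>x. g \<otimes> x) \<one> A"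
  shows "field \<xi> g d = A (\<xi> chart1)"
  using assms has_local_derivative_frechet[OF assms(3)]
  by (simp add: left_invariant_field_def tangent_map_def Let_def)

lemma field_outside: "g \<in> points M \<Longrightarrow> d \<notin> charts_at M g \<Longrightarrow> field \<xi> g d = 0"
  by (simp add: left_invariant_field_def tangent_map_def Let_def points)

text \<open>A map that commutes with right multiplications preserves left-invariant fields. Left
  translations give invariance of the field; the identity, between two charts, gives its
  transformation law.\<close>

lemma field_local_derivative:
  assumes h: "h \<in> carrier G" and d: "d \<in> charts_at M h" and e: "e \<in> charts_at M (f h)"
    and B: "has_local_derivative d e f h B"
    and f: "\<And>x. x \<in> carrier G \<Longrightarrow> f (h \<otimes> x) = f h \<otimes> x"
  shows "field \<xi> (f h) e = B (field \<xi> h d)"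
proof -
  obtain A where A: "has_local_derivative chart1 d (\<lambda>x. h \<otimes> x) \<one> A"
    using left_mult_local_derivative_exists[OF h chart1, of d] d h by auto
  have "has_local_derivative chart1 e (\<lambda>x. f (h \<otimes> x)) \<one> (\<lambda>v. B (A v))"
    by (rule has_local_derivative_compose[OF manifold_chartsD(2,3)[OF charts chart1]
          manifold_chartsD(2)[OF charts d] A]) (simp add: h B)
  then have "has_local_derivative chart1 e (\<lambda>x. f h \<otimes> x) \<one> (\<lambda>v. B (A v))"
  proof (rule has_local_derivative_transform)
    show "\<forall>\<^sub>F y in nhds (coord chart1 \<one>). f (h \<otimes> param chart1 y) = f h \<otimes> param chart1 y"
      using is_chart_eventually_dom[OF manifold_chartsD(1,3)[OF charts chart1]]
      by eventually_elim (use f chart_dom_carrier[OF chart1] in auto)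
  qed
  then show ?thesis
    using field_eq[OF _ e] field_eq[OF h d A] manifold_chartsD(4)[OF charts e] points by simp
qed

lemma field_tscale:
  assumes "g \<in> carrier G" "d \<in> charts_at M g"
  shows "field (tscale a \<xi>) g d = a *\<^sub>R field \<xi> g d"
proof -
  obtain A where A: "has_local_derivative chart1 d (\<lambda>x. g \<otimes> x) \<one> A"
    using left_mult_local_derivative_exists[OF assms(1) chart1, of d] assms by auto
  show ?thesis
    using field_eq[OF assms A] linear_cmul[OF has_local_derivative_linear[OF A]]
    by (simp add: tscale_def)
qed

text \<open>In coordinates the field is the derivative of the multiplication at
  \<open>(g, \<one>)\<close> in the direction \<open>(0, \<xi> chart1)\<close>, so it is C^1 near
  \<open>g0\<close>; the estimate is the one on the product, restricted to the slice through the
  identity.\<close>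

lemma field_locally_lipschitz:
  assumes d: "d \<in> charts_at M g0"
  obtains r L where "r > 0" "cball (coord d g0) r \<subseteq> coord d ` dom_of d"
    "L-lipschitz_on (cball (coord d g0) r) (\<lambda>y. field \<xi> (param d y) d)"
proof -
  let ?C = "prod_chart d chart1" and ?m = "\<lambda>(g, h). g \<otimes> h"
  let ?S = "coord ?C ` (dom_of ?C \<inter> ?m -` dom_of d)" and ?F = "coord d \<circ> ?m \<circ> param ?C"
  let ?z1 = "coord chart1 \<one>"
  let ?f = "\<lambda>z. frechet_derivative ?F (at z) (0, \<xi> chart1)"
  note dd = manifold_chartsD[OF charts d] and cc = manifold_chartsD[OF charts chart1]
  have C: "?C \<in> charts_at (prod_mfd M M) (g0, \<one>)"
    using d chart1 unfolding charts_at_prod by blast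
  have at: "?C \<in> atlas (prod_mfd M M)" "d \<in> atlas M"
    using C d unfolding charts_at_def by blast+
  have S: "open ?S"
    by (rule Cr_map_local_domain_open[OF smooth_mult manifold_charts_prod[OF charts charts] charts at])
  have z0: "(coord d g0, ?z1) \<in> ?S"
  proof -
    have "(g0, \<one>) \<in> dom_of ?C \<inter> ?m -` dom_of d"
      using dd cc points by simp
    then show ?thesis by (force intro: rev_image_eqI)
  qed
  have "Cr_on \<infinity> ?S ?F"
    using smooth_mult at unfolding Cr_map_def by blast
  \<comment> \<open>One derivative is spent on forming the field, the other on its Lipschitz
    bound.\<close>
  then have "times_differentiable_on (Suc (Suc 0)) ?S ?F"
    unfolding Cr_on_def by simp
  then have "times_differentiable_on (Suc 0) ?S ?f"
    unfolding times_differentiable_on.simps(2)[of "Suc 0"] by blast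
  from C1_locally_lipschitz[OF this S z0] obtain r L where
    r: "r > 0" "cball (coord d g0, ?z1) r \<subseteq> ?S" and L: "L-lipschitz_on (cball (coord d g0, ?z1) r) ?f"
    by blast
  have in_ball: "(y, ?z1) \<in> cball (coord d g0, ?z1) r" if "y \<in> cball (coord d g0) r" for y
    using that by (simp add: dist_Pair_Pair)
  have y: "y \<in> coord d ` dom_of d \<and> field \<xi> (param d y) d = ?f (y, ?z1)"
    if y: "y \<in> cball (coord d g0) r" for y
  proof -
    obtain g h where gh: "g \<in> dom_of d" "h \<in> dom_of chart1" "y = coord d g" "?z1 = coord chart1 h"
      using in_ball[OF y] r(2) by auto
    have g: "d \<in> charts_at M g" "g \<in> carrier G"
      using gh(1) d chart_dom_carrier[OF d] by (auto simp: charts_at_def)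
    have "field \<xi> g d = ?f (coord ?C (g, \<one>))"
      using field_eq[OF g(2,1) left_mult_has_local_derivative[OF g(1) chart1]] g by simp
    then show ?thesis
      using gh param_coord[OF dd(2) gh(1)] by simp
  qed
  show ?thesis
  proof
    show "r > 0" by fact
    show "cball (coord d g0) r \<subseteq> coord d ` dom_of d" using y by blast
    show "L-lipschitz_on (cball (coord d g0) r) (\<lambda>y. field \<xi> (param d y) d)"
    proof (rule lipschitz_onI)
      fix x z assume "x \<in> cball (coord d g0) r" "z \<in> cball (coord d g0) r"
      then show "dist (field \<xi> (param d x) d) (field \<xi> (param d z) d) \<le> L * dist x z"
        using lipschitz_onD[OF L in_ball in_ball] y by (simp add: dist_Pair_Pair)
    qed (rule lipschitz_on_nonneg[OF L])
  qed
qed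

section \<open>Integral curves of left-invariant fields\<close>

lemma field_curve_left_mult:
  assumes g: "g \<in> carrier G" and \<gamma>: "has_velocity M \<gamma> s (field \<xi> (\<gamma> s))"
  shows "has_velocity M (\<lambda>s. g \<otimes> \<gamma> s) s (field \<xi> (g \<otimes> \<gamma> s))"
proof (rule has_velocity_compose[OF charts \<gamma>])
  have h: "\<gamma> s \<in> carrier G" using \<gamma> points by (simp add: has_velocity_def)
  then show "g \<otimes> \<gamma> s \<in> points M" using g points by simp
  fix d assume d: "d \<in> charts_at M (g \<otimes> \<gamma> s)"
  have c: "chart_at M (\<gamma> s) \<in> charts_at M (\<gamma> s)"
    using chart_at_in[OF charts] h points by simp
  obtain A where A: "has_local_derivative (chart_at M (\<gamma> s)) d (\<lambda>x. g \<otimes> x) (\<gamma> s) A"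
    using left_mult_local_derivative_exists[OF g c d] .
  show "\<exists>c\<in>charts_at M (\<gamma> s). \<exists>A. has_local_derivative c d (\<lambda>x. g \<otimes> x) (\<gamma> s) A \<and>
      field \<xi> (g \<otimes> \<gamma> s) d = A (field \<xi> (\<gamma> s) c)"
    using c A field_local_derivative[OF h c d A] g h m_assoc by metis
qed

text \<open>For a short time both curves stay in the chart domain and in the Lipschitz ball, so
  uniqueness holds for the coordinate equation; injectivity of the chart lifts it to the
  group.\<close>

lemma field_curve_local_uniqueness:
  assumes \<gamma>: "\<forall>\<^sub>F s in nhds s0. has_velocity M \<gamma> s (field \<xi> (\<gamma> s))"
    and \<delta>: "\<forall>\<^sub>F s in nhds s0. has_velocity M \<delta> s (field \<xi> (\<delta> s))"
    and eq: "\<gamma> s0 = \<delta> s0"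
  shows "\<forall>\<^sub>F s in nhds s0. \<gamma> s = \<delta> s"
proof -
  have "\<gamma> s0 \<in> points M"
    using eventually_nhds_x_imp_x[OF \<gamma>] by (simp add: has_velocity_def)
  then obtain d where d: "d \<in> charts_at M (\<gamma> s0)"
    using chart_at_in[OF charts] by blast
  note dd = manifold_chartsD[OF charts d]
  obtain r L where r: "r > 0" "cball (coord d (\<gamma> s0)) r \<subseteq> coord d ` dom_of d"
    and L: "L-lipschitz_on (cball (coord d (\<gamma> s0)) r) (\<lambda>y. field \<xi> (param d y) d)"
    using field_locally_lipschitz[OF d] .
  let ?B = "cball (coord d (\<gamma> s0)) r" and ?f = "\<lambda>y. field \<xi> (param d y) d"
  have *: "\<forall>\<^sub>F s in nhds s0. \<eta> s \<in> dom_of d \<and> (coord d \<circ> \<eta>) s \<in> ?B \<and>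
      ((coord d \<circ> \<eta>) has_vector_derivative ?f ((coord d \<circ> \<eta>) s)) (at s)"
    if \<eta>: "\<forall>\<^sub>F s in nhds s0. has_velocity M \<eta> s (field \<xi> (\<eta> s))" and "\<eta> s0 = \<gamma> s0" for \<eta>
  proof -
    have \<eta>0: "has_velocity M \<eta> s0 (field \<xi> (\<eta> s0))" and d': "d \<in> charts_at M (\<eta> s0)"
      using eventually_nhds_x_imp_x[OF \<eta>] d that(2) by auto
    note v = has_velocity_curve[OF \<eta>0 d']
    have "isCont (coord d \<circ> \<eta>) s0"
      using v(2) has_vector_derivative_continuous by blast
    then have "filterlim (coord d \<circ> \<eta>) (nhds ((coord d \<circ> \<eta>) s0)) (nhds s0)"
      by (simp only: isCont_def tendsto_at_iff_tendsto_nhds)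
    moreover have "\<forall>\<^sub>F y in nhds ((coord d \<circ> \<eta>) s0). y \<in> ball (coord d (\<gamma> s0)) r"
      using that(2) r(1) by (intro eventually_nhds_in_open) auto
    ultimately have "\<forall>\<^sub>F s in nhds s0. (coord d \<circ> \<eta>) s \<in> ball (coord d (\<gamma> s0)) r"
      using eventually_compose_filterlim by blast
    with v(1) \<eta> show ?thesis
    proof eventually_elim
      case (elim s)
      have "d \<in> charts_at M (\<eta> s)" using elim(1) d by (simp add: charts_at_def)
      from has_velocity_curve(2)[OF elim(2) this] show ?case
        using elim param_coord[OF dd(2) elim(1)] by simp
    qed
  qed
  note u = *[OF \<gamma> refl] and v = *[OF \<delta> eq[symmetric]]
  have "\<forall>\<^sub>F s in nhds s0. (coord d \<circ> \<gamma>) s = (coord d \<circ> \<delta>) s"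
    by (rule ode_local_uniqueness[where u="coord d \<circ> \<gamma>" and v="coord d \<circ> \<delta>",
          OF L eventually_mono[OF u] eventually_mono[OF v]]) (use eq in auto)
  with u v show ?thesis
    by eventually_elim (use dd(2) in \<open>auto dest: inj_onD\<close>)
qed

text \<open>The set of agreement is open by local uniqueness, the set of disagreement by Hausdorff
  separation and continuity; connectedness of \<open>I\<close> leaves only the first.\<close>

lemma field_curve_uniqueness:
  assumes I: "open I" "connected I" "s0 \<in> I" "s \<in> I"
    and \<gamma>: "\<And>s. s \<in> I \<Longrightarrow> has_velocity M \<gamma> s (field \<xi> (\<gamma> s))"
    and \<delta>: "\<And>s. s \<in> I \<Longrightarrow> has_velocity M \<delta> s (field \<xi> (\<delta> s))"
    and eq: "\<gamma> s0 = \<delta> s0"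
  shows "\<gamma> s = \<delta> s"
proof -
  let ?A = "{s \<in> I. \<gamma> s = \<delta> s}" and ?B = "{s \<in> I. \<gamma> s \<noteq> \<delta> s}"
  have ev: "\<forall>\<^sub>F s' in nhds s. s' \<in> I" if "s \<in> I" for s
    using I(1) that by (rule eventually_nhds_in_open)
  have "open ?A"
  proof (rule Topological_Spaces.openI)
    fix s assume s: "s \<in> ?A"
    have "\<forall>\<^sub>F s in nhds s. \<gamma> s = \<delta> s"
      by (rule field_curve_local_uniqueness)
        (use s ev[of s] \<gamma> \<delta> in \<open>auto elim!: eventually_mono\<close>)
    with ev[of s] s have "\<forall>\<^sub>F s' in nhds s. s' \<in> ?A"
      by (auto elim: eventually_elim2)
    then show "\<exists>T. open T \<and> s \<in> T \<and> T \<subseteq> ?A"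
      unfolding eventually_nhds by auto
  qed
  moreover have "open ?B"
  proof (rule Topological_Spaces.openI)
    fix s assume s: "s \<in> ?B"
    then have v: "has_velocity M \<gamma> s (field \<xi> (\<gamma> s))" "has_velocity M \<delta> s (field \<xi> (\<delta> s))"
      using \<gamma> \<delta> by auto
    then obtain U V where UV: "openin (mfd_top M) U" "openin (mfd_top M) V" "\<gamma> s \<in> U" "\<delta> s \<in> V"
        "disjnt U V"
      using s smooth unfolding smooth_manifold_def Hausdorff_space_def has_velocity_def by blast
    have "\<forall>\<^sub>F s' in nhds s. s' \<in> I" using s ev by blast
    with has_velocity_eventually[OF charts v(1) UV(1,3)] has_velocity_eventually[OF charts v(2) UV(2,4)]
    have "\<forall>\<^sub>F s' in nhds s. s' \<in> ?B"
      by eventually_elim (use UV(5) in \<open>auto simp: disjnt_iff\<close>)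
    then show "\<exists>T. open T \<and> s \<in> T \<and> T \<subseteq> ?B"
      unfolding eventually_nhds by auto
  qed
  ultimately have "?A \<inter> I = {} \<or> ?B \<inter> I = {}"
    by (intro connectedD[OF I(2)]) auto
  then show ?thesis using I eq by auto
qed

lemma field_curve_local_existence:
  obtains \<epsilon> \<sigma> where "\<epsilon> > 0" "\<sigma> 0 = \<one>" "\<forall>s. \<bar>s\<bar> < \<epsilon> \<longrightarrow> has_velocity M \<sigma> s (field \<xi> (\<sigma> s))"
proof -
  note cc = manifold_chartsD[OF charts chart1]
  obtain r L where r: "r > 0" "cball (coord chart1 \<one>) r \<subseteq> coord chart1 ` dom_of chart1"
    and L: "L-lipschitz_on (cball (coord chart1 \<one>) r) (\<lambda>y. field \<xi> (param chart1 y) chart1)"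
    using field_locally_lipschitz[OF chart1] .
  obtain u \<epsilon> where e: "\<epsilon> > 0" "u 0 = coord chart1 \<one>"
    and "\<forall>s. \<bar>s\<bar> < \<epsilon> \<longrightarrow> u s \<in> cball (coord chart1 \<one>) r \<and>
        (u has_vector_derivative field \<xi> (param chart1 (u s)) chart1) (at s)"
    using ode_local_existence[OF r(1) L] .
  then have u: "u s \<in> cball (coord chart1 \<one>) r \<and>
      (u has_vector_derivative field \<xi> (param chart1 (u s)) chart1) (at s)" if "\<bar>s\<bar> < \<epsilon>" for s
    using that by blast
  have p: "param chart1 (u s) \<in> dom_of chart1 \<and> coord chart1 (param chart1 (u s)) = u s"
    if s: "\<bar>s\<bar> < \<epsilon>" for s
  proof -
    obtain g where "g \<in> dom_of chart1" "u s = coord chart1 g"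
      using u[OF s] r(2) by blast
    then show ?thesis using param_coord[OF cc(2)] by simp
  qed
  show ?thesis
  proof (rule that[OF e(1)], safe)
    show "param chart1 (u 0) = \<one>" using e(2) param_coord[OF cc(2,3)] by simp
    fix s :: real assume s: "\<bar>s\<bar> < \<epsilon>"
    let ?g = "param chart1 (u s)"
    have c: "chart1 \<in> charts_at M ?g" and g: "?g \<in> carrier G"
      using p[OF s] chart1 chart_dom_carrier[OF chart1] by (auto simp: charts_at_def)
    show "has_velocity M (\<lambda>s. param chart1 (u s)) s (field \<xi> ?g)"
    proof (rule has_velocity_chartI[OF smooth, where c=chart1])
      show "chart1 \<in> charts_at M ?g" by (rule c)
      have I: "open {-\<epsilon><..<\<epsilon>}" "s \<in> {-\<epsilon><..<\<epsilon>}" using s by auto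
      have "((coord chart1 \<circ> (\<lambda>s. param chart1 (u s))) has_derivative (\<lambda>h. h *\<^sub>R field \<xi> ?g chart1)) (at s)"
        by (rule has_derivative_transform_within_open
            [OF conjunct2[OF u[OF s], unfolded has_vector_derivative_def] I]) (use p in auto)
      moreover have "\<forall>\<^sub>F s' in nhds s. param chart1 (u s') \<in> dom_of chart1"
        using eventually_nhds_in_open[OF I] by eventually_elim (use p in auto)
      ultimately show "has_local_derivative (UNIV, id) chart1 (\<lambda>s. param chart1 (u s)) s
          (\<lambda>h. h *\<^sub>R field \<xi> ?g chart1)"
        by (simp add: has_local_derivative_curve)
      \<comment> \<open>The transformation law of the field: the case of the identity map.\<close>
      show "field \<xi> ?g d = A (field \<xi> ?g chart1)"
        if "d \<in> charts_at M ?g" "has_local_derivative chart1 d (\<lambda>x. x) ?g A" for d A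
        using field_local_derivative[where f="\<lambda>x. x", OF g c that] by simp
    qed
  qed
qed

text \<open>A local integral curve \<open>\<sigma>\<close> through the identity is continued by left translation: near
  \<open>k * \<epsilon>\<close> the global curve is \<open>\<sigma> \<epsilon> [^] k \<otimes> \<sigma> (s - k * \<epsilon>)\<close>, and consecutive pieces agree
  where they overlap because they meet at \<open>k * \<epsilon>\<close>.\<close>

lemma field_curve_global_existence:
  obtains \<gamma> where "\<gamma> 0 = \<one>" "\<forall>s. has_velocity M \<gamma> s (field \<xi> (\<gamma> s))"
proof -
  obtain \<sigma> \<epsilon>2 where "\<epsilon>2 > 0" and \<sigma>0: "\<sigma> 0 = \<one>"
    and \<sigma>2: "\<forall>s. \<bar>s\<bar> < \<epsilon>2 \<longrightarrow> has_velocity M \<sigma> s (field \<xi> (\<sigma> s))"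
    using field_curve_local_existence[of \<xi>] .
  \<comment> \<open>Halving the existence time makes \<open>\<sigma> \<epsilon>\<close> available as
    the translating element and makes neighbouring pieces overlap.\<close>
  define \<epsilon> where "\<epsilon> = \<epsilon>2 / 2"
  have e: "\<epsilon> > 0" using \<open>\<epsilon>2 > 0\<close> by (simp add: \<epsilon>_def)
  have \<sigma>: "has_velocity M \<sigma> s (field \<xi> (\<sigma> s))" if "\<bar>s\<bar> < 2 * \<epsilon>" for s
    using \<sigma>2 that by (simp add: \<epsilon>_def)
  have a: "\<sigma> \<epsilon> \<in> carrier G"
    using \<sigma>[of \<epsilon>] e points by (simp add: has_velocity_def)
  define p where "p k s = (\<sigma> \<epsilon> [^] k) \<otimes> \<sigma> (s - of_int k * \<epsilon>)" for k :: int and s :: real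
  define \<gamma> where "\<gamma> s = p \<lfloor>s / \<epsilon>\<rfloor> s" for s
  have p: "has_velocity M (p k) s (field \<xi> (p k s))" if "\<bar>s - of_int k * \<epsilon>\<bar> < 2 * \<epsilon>" for k s
  proof -
    have "has_velocity M (\<lambda>s. \<sigma> (1 * s + - (of_int k * \<epsilon>))) s
        (\<lambda>d. 1 *\<^sub>R field \<xi> (\<sigma> (s - of_int k * \<epsilon>)) d)"
      by (rule has_velocity_affine) (use \<sigma>[OF that] in simp)
    then have "has_velocity M (\<lambda>s. \<sigma> (s - of_int k * \<epsilon>)) s (field \<xi> (\<sigma> (s - of_int k * \<epsilon>)))"
      by simp
    from field_curve_left_mult[OF _ this, of "\<sigma> \<epsilon> [^] k"] show ?thesis
      using a by (simp add: p_def[abs_def])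
  qed
  have p_step: "p (k - 1) s = p k s" if s: "s \<in> {of_int (k - 1) * \<epsilon><..<of_int (k + 1) * \<epsilon>}" for k s
  proof (rule field_curve_uniqueness[OF _ _ _ s])
    show "has_velocity M (p (k - 1)) s (field \<xi> (p (k - 1) s))" "has_velocity M (p k) s (field \<xi> (p k s))"
      if "s \<in> {of_int (k - 1) * \<epsilon><..<of_int (k + 1) * \<epsilon>}" for s
      using that e by (auto intro!: p simp: algebra_simps abs_less_iff)
    show "of_int k * \<epsilon> \<in> {of_int (k - 1) * \<epsilon><..<of_int (k + 1) * \<epsilon>}"
      using e by (simp add: algebra_simps)
    show "p (k - 1) (of_int k * \<epsilon>) = p k (of_int k * \<epsilon>)"
    proof -
      have "\<sigma> \<epsilon> [^] k = \<sigma> \<epsilon> [^] (k - 1) \<otimes> \<sigma> \<epsilon>"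
        using int_pow_mult[OF a, of "k - 1" 1] a by simp
      then show ?thesis using a by (simp add: p_def \<sigma>0 algebra_simps)
    qed
  qed auto
  show ?thesis
  proof (rule that, safe)
    show "\<gamma> 0 = \<one>" by (simp add: \<gamma>_def p_def \<sigma>0)
    fix s
    define k where "k = \<lfloor>s / \<epsilon>\<rfloor>"
    let ?I = "{of_int (k - 1) * \<epsilon><..<of_int (k + 1) * \<epsilon>}"
    have k: "of_int k * \<epsilon> \<le> s" "s < of_int (k + 1) * \<epsilon>"
      using e floor_divide_lower[of \<epsilon> s] floor_divide_upper[of \<epsilon> s] by (auto simp: k_def)
    \<comment> \<open>At \<open>k * \<epsilon>\<close> the floor jumps, but the pieces
      \<open>k - 1\<close> and \<open>k\<close> agree around it, so \<open>p k\<close> represents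
      \<open>\<gamma>\<close> on both sides.\<close>
    have "\<gamma> s' = p k s'" if s': "s' \<in> ?I" for s'
    proof (cases "s' < of_int k * \<epsilon>")
      case True
      then have "\<lfloor>s' / \<epsilon>\<rfloor> = k - 1"
        using s' e by (intro floor_unique) (auto simp: field_simps)
      then show ?thesis using p_step[OF s'] by (simp add: \<gamma>_def)
    next
      case False
      then have "\<lfloor>s' / \<epsilon>\<rfloor> = k"
        using s' e by (intro floor_unique) (auto simp: field_simps)
      then show ?thesis by (simp add: \<gamma>_def)
    qed
    moreover have sI: "s \<in> ?I"
      using k e by (auto simp: algebra_simps)
    ultimately have "\<forall>\<^sub>F s' in nhds s. p k s' = \<gamma> s'" "\<gamma> s = p k s"
      using eventually_nhds_in_open[OF open_greaterThanLessThan sI] by (auto elim: eventually_mono)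
    moreover have "has_velocity M (p k) s (field \<xi> (p k s))"
      using k e by (intro p) (auto simp: algebra_simps abs_less_iff)
    ultimately show "has_velocity M \<gamma> s (field \<xi> (\<gamma> s))"
      using has_velocity_transform by metis
  qed
qed

text \<open>Running the curve of \<open>\<xi>\<close> at speed \<open>s\<close> gives the integral
  curve of the scaled field through the identity. Uniqueness identifies it with the one described in
  \<open>lie_exp\<close>, and its time-one point is \<open>\<gamma> s\<close>.\<close>

lemma lie_exp_one_parameter:
  obtains \<gamma> where "\<gamma> 0 = \<one>" "\<forall>s. has_velocity M \<gamma> s (field \<xi> (\<gamma> s))"
    "\<forall>s. lie_exp G M (tscale s \<xi>) = \<gamma> s"
proof -
  obtain \<gamma> where \<gamma>: "\<gamma> 0 = \<one>" "\<forall>s. has_velocity M \<gamma> s (field \<xi> (\<gamma> s))"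
    using field_curve_global_existence[of \<xi>] .
  have "lie_exp G M (tscale s \<xi>) = \<gamma> s" for s
  proof -
    let ?P = "\<lambda>\<delta>. integral_curve M (field (tscale s \<xi>)) \<delta> \<and> \<delta> 0 = \<one>"
    note ic = integral_curve_iff_has_velocity[OF charts, of "field (tscale s \<xi>)", OF field_outside]
    have "has_velocity M (\<lambda>\<tau>. \<gamma> (s * \<tau>)) \<tau> (field (tscale s \<xi>) (\<gamma> (s * \<tau>)))" for \<tau>
    proof -
      have "has_velocity M (\<lambda>\<tau>. \<gamma> (s * \<tau>)) \<tau> (\<lambda>d. s *\<^sub>R field \<xi> (\<gamma> (s * \<tau>)) d)"
        using has_velocity_affine[of M \<gamma> s \<tau> 0] \<gamma>(2) by simp
      then show ?thesis
        using field_tscale points by (simp add: has_velocity_def)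
    qed
    then have "?P (\<lambda>\<tau>. \<gamma> (s * \<tau>))"
      using \<gamma>(1) by (simp add: ic)
    moreover have "\<delta> = (\<lambda>\<tau>. \<gamma> (s * \<tau>))" if "?P \<delta>" for \<delta>
    proof
      fix \<tau>
      show "\<delta> \<tau> = \<gamma> (s * \<tau>)"
        by (rule field_curve_uniqueness[of UNIV 0 \<tau> \<delta> "tscale s \<xi>" "\<lambda>\<tau>. \<gamma> (s * \<tau>)"])
          (use calculation that in \<open>auto simp: ic\<close>)
    qed
    ultimately have "(THE \<delta>. ?P \<delta>) = (\<lambda>\<tau>. \<gamma> (s * \<tau>))"
      by (rule the_equality)
    then show ?thesis by (simp add: lie_exp_def)
  qed
  with \<gamma> that show ?thesis by blast
qed

end


section \<open>Tangent vectors of products and generators of actions\<close>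

lemma has_velocity_velocity:
  assumes "has_velocity M \<gamma> s v"
  shows "has_velocity M \<gamma> s (velocity M \<gamma> s)"
  using assms has_velocity_imp_velocity[OF assms] by (simp add: has_velocity_def)

text \<open>The derivative of the curve in \<open>d\<close>, taken directly or through
  \<open>c\<close>, is unique; evaluating both forms at 1 gives the compatibility condition.\<close>

lemma velocity_in_tangent_space:
  assumes M: "smooth_manifold M" and \<gamma>: "has_velocity M \<gamma> s v"
  shows "velocity M \<gamma> s \<in> tangent_space M (\<gamma> s)"
proof (rule tangent_spaceI[OF _ _ M])
  show "velocity M \<gamma> s c = 0" if "c \<notin> charts_at M (\<gamma> s)" for c
    using that by (simp add: velocity_def)
next
  fix c d A
  assume c: "c \<in> charts_at M (\<gamma> s)" and d: "d \<in> charts_at M (\<gamma> s)"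
    and A: "has_local_derivative c d (\<lambda>x. x) (\<gamma> s) A"
  let ?v = "velocity M \<gamma> s"
  note v = has_velocity_velocity[OF \<gamma>, unfolded has_velocity_def, THEN conjunct2, rule_format]
  have "has_local_derivative (UNIV, id) d \<gamma> s (\<lambda>h. A (h *\<^sub>R ?v c))"
    by (rule has_local_derivative_compose[OF _ _ manifold_chartsD(2)[OF smooth_manifold_charts[OF M] c]
          v[OF c] A]) auto
  from has_local_derivative_unique[OF v[OF d] this]
  have "1 *\<^sub>R ?v d = A (1 *\<^sub>R ?v c)" by (rule fun_cong)
  then show "?v d = A (?v c)" by simp
qed

lemma velocity_Pair:
  assumes \<gamma>: "has_velocity M \<gamma> s v" and \<delta>: "has_velocity N \<delta> s w"
    and c: "c \<in> charts_at M (\<gamma> s)" and d: "d \<in> charts_at N (\<delta> s)"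
  shows "velocity (prod_mfd M N) (\<lambda>s. (\<gamma> s, \<delta> s)) s (prod_chart c d) =
           (velocity M \<gamma> s c, velocity N \<delta> s d)"
proof -
  have "has_local_derivative (UNIV, id) (prod_chart c d) (\<lambda>s. (\<gamma> s, \<delta> s)) s
      (\<lambda>h. (h *\<^sub>R v c, h *\<^sub>R w d))"
    by (rule has_local_derivative_Pair) (use \<gamma> \<delta> c d in \<open>auto simp: has_velocity_def\<close>)
  then have "((coord (prod_chart c d) \<circ> (\<lambda>s. (\<gamma> s, \<delta> s))) has_vector_derivative (v c, w d)) (at s)"
    unfolding has_local_derivative_curve has_vector_derivative_def scaleR_Pair by blast
  moreover have "prod_chart c d \<in> charts_at (prod_mfd M N) (\<gamma> s, \<delta> s)"
    using c d unfolding charts_at_prod by blast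
  ultimately show ?thesis
    using vector_derivative_at has_velocity_imp_velocity[OF \<gamma> c] has_velocity_imp_velocity[OF \<delta> d]
    by (simp add: velocity_def[of "prod_mfd M N"])
qed

text \<open>The product atlas contains only product charts, so even an arbitrarily chosen chart
  splits, though not necessarily into the charts chosen on the factors.\<close>

lemma chart_at_prod:
  assumes "manifold_charts M" "manifold_charts N" "x \<in> points M" "y \<in> points N"
  obtains c d where "chart_at (prod_mfd M N) (x, y) = prod_chart c d"
    "c \<in> charts_at M x" "d \<in> charts_at N y" "prod_chart c d \<in> charts_at (prod_mfd M N) (x, y)"
proof -
  have C: "chart_at (prod_mfd M N) (x, y) \<in> charts_at (prod_mfd M N) (x, y)"
    using assms by (intro chart_at_in manifold_charts_prod) (auto simp: points_prod)
  then obtain c d where cd: "chart_at (prod_mfd M N) (x, y) = prod_chart c d"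
    "c \<in> charts_at M x" "d \<in> charts_at N y"
    unfolding charts_at_prod mem_Collect_eq by (elim exE conjE)
  show ?thesis
    by (rule that[OF cd]) (use C in \<open>simp only: cd(1)\<close>)
qed

lemma tangent_space_local_derivative:
  assumes "v \<in> tangent_space M q" "c \<in> charts_at M q" "d \<in> charts_at M q"
    "has_local_derivative c d (\<lambda>x. x) q A"
  shows "v d = A (v c)"
proof -
  have "v d = frechet_derivative (coord d \<circ> param c) (at (coord c q)) (v c)"
    using assms(1-3) unfolding tangent_space_def by blast
  also have "coord d \<circ> param c = coord d \<circ> (\<lambda>x. x) \<circ> param c"
    by (simp add: comp_def)
  finally show ?thesis
    by (simp only: has_local_derivative_frechet[OF assms(4)])
qed

text \<open>The tangent map reads \<open>w\<close> in one product chart only; membership of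
  \<open>v\<close> in the tangent space supplies its components in all other charts and the value 0
  elsewhere.\<close>

lemma tangent_map_fst:
  assumes M: "smooth_manifold M" and N: "smooth_manifold N" and x: "x \<in> points M" and y: "y \<in> points N"
    and v: "v \<in> tangent_space M x"
    and w: "\<And>c d. c \<in> charts_at M x \<Longrightarrow> d \<in> charts_at N y \<Longrightarrow> w (prod_chart c d) = (v c, u d)"
  shows "tangent_map (prod_mfd M N) M fst (x, y) w = v"
proof
  fix e
  note mM = smooth_manifold_charts[OF M] and mN = smooth_manifold_charts[OF N]
  obtain c d where C: "chart_at (prod_mfd M N) (x, y) = prod_chart c d"
    and c: "c \<in> charts_at M x" and d: "d \<in> charts_at N y"
    and cd: "prod_chart c d \<in> charts_at (prod_mfd M N) (x, y)"
    using chart_at_prod[OF mM mN x y] .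
  show "tangent_map (prod_mfd M N) M fst (x, y) w e = v e"
  proof (cases "e \<in> charts_at M x")
    case True
    obtain A where A: "has_local_derivative c e (\<lambda>x. x) x A"
      using transition_has_local_derivative[OF M c True] by blast
    have F: "has_local_derivative (prod_chart c d) c fst (x, y) fst"
      by (rule has_local_derivative_fst) (use manifold_chartsD[OF mM c] manifold_chartsD[OF mN d] in auto)
    have "has_local_derivative (prod_chart c d) e fst (x, y) (\<lambda>v. A (fst v))"
      by (rule has_local_derivative_compose[OF
            manifold_chartsD(2,3)[OF manifold_charts_prod[OF mM mN] cd] manifold_chartsD(2)[OF mM c] F])
        (simp add: A)
    from has_local_derivative_frechet[OF this] show ?thesis
      using True w[OF c d] tangent_space_local_derivative[OF v c True A]
      by (simp add: tangent_map_def C Let_def)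
  next
    case False
    then have "v e = 0" using v unfolding tangent_space_def by blast
    with False show ?thesis by (simp add: tangent_map_def Let_def)
  qed
qed

lemma tangent_map_snd:
  assumes M: "smooth_manifold M" and N: "smooth_manifold N" and x: "x \<in> points M" and y: "y \<in> points N"
    and u: "u \<in> tangent_space N y"
    and w: "\<And>c d. c \<in> charts_at M x \<Longrightarrow> d \<in> charts_at N y \<Longrightarrow> w (prod_chart c d) = (v c, u d)"
  shows "tangent_map (prod_mfd M N) N snd (x, y) w = u"
proof
  fix e
  note mM = smooth_manifold_charts[OF M] and mN = smooth_manifold_charts[OF N]
  obtain c d where C: "chart_at (prod_mfd M N) (x, y) = prod_chart c d"
    and c: "c \<in> charts_at M x" and d: "d \<in> charts_at N y"
    and cd: "prod_chart c d \<in> charts_at (prod_mfd M N) (x, y)"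
    using chart_at_prod[OF mM mN x y] .
  show "tangent_map (prod_mfd M N) N snd (x, y) w e = u e"
  proof (cases "e \<in> charts_at N y")
    case True
    obtain A where A: "has_local_derivative d e (\<lambda>x. x) y A"
      using transition_has_local_derivative[OF N d True] by blast
    have F: "has_local_derivative (prod_chart c d) d snd (x, y) snd"
      by (rule has_local_derivative_snd) (use manifold_chartsD[OF mM c] manifold_chartsD[OF mN d] in auto)
    have "has_local_derivative (prod_chart c d) e snd (x, y) (\<lambda>v. A (snd v))"
      by (rule has_local_derivative_compose[OF
            manifold_chartsD(2,3)[OF manifold_charts_prod[OF mM mN] cd] manifold_chartsD(2)[OF mN d] F])
        (simp add: A)
    from has_local_derivative_frechet[OF this] show ?thesis
      using True w[OF c d] tangent_space_local_derivative[OF u d True A]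
      by (simp add: tangent_map_def C Let_def)
  next
    case False
    then have "u e = 0" using u unfolding tangent_space_def by blast
    with False show ?thesis by (simp add: tangent_map_def Let_def)
  qed
qed

lemma differential_eq:
  assumes "has_local_derivative (chart_at M q) (UNIV, id) f q A"
  shows "differential M f q v = A (v (chart_at M q))"
  using has_local_derivative_frechet[OF assms] by (simp add: differential_def Let_def comp_def)

text \<open>Total differentiability provides one linear map \<open>B\<close> in a product chart; the
  two partial differentials are its values on the axes.\<close>

lemma differential_prod:
  assumes Q: "smooth_manifold Q" and f: "Cr_map r (prod_mfd Q Q) euclidean_mfd (\<lambda>(x, y). f x y)" "1 \<le> r"
    and x: "x \<in> points Q" and y: "y \<in> points Q"
    and v: "v \<in> tangent_space Q x" and u: "u \<in> tangent_space Q y"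
    and w: "\<And>c d. c \<in> charts_at Q x \<Longrightarrow> d \<in> charts_at Q y \<Longrightarrow> w (prod_chart c d) = (v c, u d)"
  shows "differential (prod_mfd Q Q) (\<lambda>(x, y). f x y) (x, y) w = D_fst Q f x y v + D_snd Q f x y u"
proof -
  note mQ = smooth_manifold_charts[OF Q]
  obtain c d where C: "chart_at (prod_mfd Q Q) (x, y) = prod_chart c d"
    and c: "c \<in> charts_at Q x" and d: "d \<in> charts_at Q y"
    and cd: "prod_chart c d \<in> charts_at (prod_mfd Q Q) (x, y)"
    using chart_at_prod[OF mQ mQ x y] .
  note cc = manifold_chartsD[OF mQ c] and dd = manifold_chartsD[OF mQ d]
    and ci = manifold_chartsD(2)[OF manifold_charts_prod[OF mQ mQ] cd]
  obtain B where B: "has_local_derivative (prod_chart c d) (UNIV, id) (\<lambda>(x, y). f x y) (x, y) B"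
    using Cr_map_has_local_derivative[OF f manifold_charts_prod[OF mQ mQ] manifold_charts_euclidean cd]
    by (auto simp: charts_at_euclidean)
  have 1: "differential (prod_mfd Q Q) (\<lambda>(x, y). f x y) (x, y) w = B (v c, u d)"
    using differential_eq[of "prod_mfd Q Q" "(x, y)" _ B w] B w[OF c d] unfolding C by simp
  \<comment> \<open>\<open>D_fst\<close> reads \<open>v\<close> in the chart chosen at
    \<open>x\<close>, which may differ from \<open>c\<close>; \<open>A\<close> converts between
    them.\<close>
  have 2: "D_fst Q f x y v = B (v c, 0)"
  proof -
    let ?c = "chart_at Q x"
    have c': "?c \<in> charts_at Q x" by (rule chart_at_in[OF mQ x])
    obtain A where A: "has_local_derivative ?c c (\<lambda>x. x) x A"
      using transition_has_local_derivative[OF Q c' c] by blast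
    have P: "has_local_derivative ?c (prod_chart c d) (\<lambda>x'. (x', y)) x (\<lambda>v. (A v, 0))"
      by (rule has_local_derivative_Pair[OF A has_local_derivative_const[OF dd(3)]])
    from has_local_derivative_compose[OF manifold_chartsD(2,3)[OF mQ c'] ci P B]
    have "has_local_derivative ?c (UNIV, id) (\<lambda>x'. f x' y) x (\<lambda>v. B (A v, 0))" by simp
    from differential_eq[OF this] show ?thesis
      using tangent_space_local_derivative[OF v c' c A] by (simp add: D_fst_def)
  qed
  have 3: "D_snd Q f x y u = B (0, u d)"
  proof -
    let ?d = "chart_at Q y"
    have d': "?d \<in> charts_at Q y" by (rule chart_at_in[OF mQ y])
    obtain A where A: "has_local_derivative ?d d (\<lambda>x. x) y A"
      using transition_has_local_derivative[OF Q d' d] by blast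
    have P: "has_local_derivative ?d (prod_chart c d) (\<lambda>y'. (x, y')) y (\<lambda>v. (0, A v))"
      by (rule has_local_derivative_Pair[OF has_local_derivative_const[OF cc(3)] A])
    from has_local_derivative_compose[OF manifold_chartsD(2,3)[OF mQ d'] ci P B]
    have "has_local_derivative ?d (UNIV, id) (\<lambda>y'. f x y') y (\<lambda>v. B (0, A v))" by simp
    from differential_eq[OF this] show ?thesis
      using tangent_space_local_derivative[OF u d' d A] by (simp add: D_snd_def)
  qed
  show ?thesis
    using linear_add[OF has_local_derivative_linear[OF B], of "(v c, 0)" "(0, u d)"]
    by (simp add: 1 2 3)
qed

section \<open>Infinitesimal generators of a Lie group action\<close>

locale lie_action = lie_grp G M
  for G :: "'g monoid" (structure) and M :: "('g, 'd::euclidean_space) mfd" +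
  fixes Q :: "('q, 'e::euclidean_space) mfd" and \<Phi> :: "'g \<Rightarrow> 'q \<Rightarrow> 'q"
  assumes Q: "smooth_manifold Q" and action: "smooth_left_action G M Q \<Phi>"
begin

abbreviation generator :: "('g, 'd) tvec \<Rightarrow> 'q \<Rightarrow> ('q, 'e) tvec" where
  "generator \<equiv> infinitesimal_generator G M Q \<Phi>"

lemma act_one: "x \<in> points Q \<Longrightarrow> \<Phi> \<one> x = x"
  using action group_action.id_eq_one[of G "points Q" \<Phi>]
  unfolding smooth_left_action_def by (metis restrict_apply')

text \<open>The orbit is a slice of the jointly smooth action composed with the one-parameter curve.
  The first claim identifies the base point, on which the charts used by \<open>velocity\<close>
  depend.\<close>

lemma exp_orbit_has_velocity:
  assumes x: "x \<in> points Q"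
  shows "\<Phi> (lie_exp G M (tscale 0 \<xi>)) x = x"
    and "\<exists>v. has_velocity Q (\<lambda>s. \<Phi> (lie_exp G M (tscale s \<xi>)) x) 0 v"
proof -
  note mQ = smooth_manifold_charts[OF Q]
  obtain \<gamma> where \<gamma>: "\<gamma> 0 = \<one>" "\<forall>s. has_velocity M \<gamma> s (field \<xi> (\<gamma> s))"
    and exp: "\<forall>s. lie_exp G M (tscale s \<xi>) = \<gamma> s"
    using lie_exp_one_parameter[of \<xi>] .
  show "\<Phi> (lie_exp G M (tscale 0 \<xi>)) x = x"
    by (simp add: exp \<gamma>(1) act_one x)
  \<comment> \<open>The value dictated by the chain rule: the derivative of the orbit map at the
    identity, applied to the initial velocity of the curve.\<close>
  define w where "w d = frechet_derivative (coord d \<circ> (\<lambda>g. \<Phi> g x) \<circ> param chart1)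
      (at (coord chart1 \<one>)) (field \<xi> \<one> chart1)"
    for d :: "('q, 'e) chart"
  have "has_velocity Q (\<lambda>s. \<Phi> (\<gamma> s) x) 0 w"
  proof (rule has_velocity_compose[OF charts \<gamma>(2)[rule_format]])
    show "\<Phi> (\<gamma> 0) x \<in> points Q" by (simp add: \<gamma>(1) act_one x)
    fix d assume "d \<in> charts_at Q (\<Phi> (\<gamma> 0) x)"
    then have d: "d \<in> charts_at Q (\<Phi> \<one> x)" "d \<in> charts_at Q x"
      by (simp_all add: \<gamma>(1) act_one x)
    let ?C = "prod_chart chart1 d"
    have C: "?C \<in> charts_at (prod_mfd M Q) (\<one>, x)"
      using chart1 d unfolding charts_at_prod by blast
    note cc = manifold_chartsD[OF charts chart1] and dd = manifold_chartsD[OF mQ d(2)]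
      and mMQ = manifold_charts_prod[OF charts mQ]
    obtain B where B: "has_local_derivative ?C d (\<lambda>(g, q). \<Phi> g q) (\<one>, x) B"
      using Cr_map_has_local_derivative[of \<infinity>, OF _ _ mMQ mQ C] action d
      unfolding smooth_left_action_def by fastforce
    have P: "has_local_derivative chart1 ?C (\<lambda>g. (g, x)) \<one> (\<lambda>v. (v, 0))"
      by (rule has_local_derivative_Pair[OF has_local_derivative_ident[OF cc(1,3)]
            has_local_derivative_const[OF dd(3)]])
    from has_local_derivative_compose[OF cc(2,3) manifold_chartsD(2)[OF mMQ C] P B]
    have A: "has_local_derivative chart1 d (\<lambda>g. \<Phi> g x) \<one> (\<lambda>v. B (v, 0))" by simp
    then show "\<exists>c\<in>charts_at M (\<gamma> 0). \<exists>A. has_local_derivative c d (\<lambda>g. \<Phi> g x) (\<gamma> 0) A \<and>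
        w d = A (field \<xi> (\<gamma> 0) c)"
      using chart1 has_local_derivative_frechet[OF A] unfolding \<gamma>(1) w_def by metis
  qed
  then show "\<exists>v. has_velocity Q (\<lambda>s. \<Phi> (lie_exp G M (tscale s \<xi>)) x) 0 v"
    by (auto simp: exp)
qed

text \<open>This makes the generator an admissible test vector in the discrete Euler-Lagrange
  equation, which ranges over \<open>tangent_space\<close>.\<close>

lemma generator_in_tangent_space:
  assumes x: "x \<in> points Q"
  shows "generator \<xi> x \<in> tangent_space Q x"
proof -
  obtain v where "has_velocity Q (\<lambda>s. \<Phi> (lie_exp G M (tscale s \<xi>)) x) 0 v"
    using exp_orbit_has_velocity(2)[OF x] by blast
  from velocity_in_tangent_space[OF Q this] show ?thesis
    by (simp add: infinitesimal_generator_def exp_orbit_has_velocity(1)[OF x])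
qed

text \<open>Both components are moved by the same exponential curve, so the diagonal orbit is the
  pair of the two orbits.\<close>

lemma diagonal_generator_prod_chart:
  assumes x: "x \<in> points Q" and y: "y \<in> points Q" and c: "c \<in> charts_at Q x" and d: "d \<in> charts_at Q y"
  shows "diagonal_generator G M Q \<Phi> \<xi> x y (prod_chart c d) = (generator \<xi> x c, generator \<xi> y d)"
proof -
  obtain v where v: "has_velocity Q (\<lambda>s. \<Phi> (lie_exp G M (tscale s \<xi>)) x) 0 v"
    using exp_orbit_has_velocity(2)[OF x] by blast
  obtain w where w: "has_velocity Q (\<lambda>s. \<Phi> (lie_exp G M (tscale s \<xi>)) y) 0 w"
    using exp_orbit_has_velocity(2)[OF y] by blast
  show ?thesis
    using velocity_Pair[OF v w, of c d] c d exp_orbit_has_velocity(1)[OF x] exp_orbit_has_velocity(1)[OF y]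
    by (simp add: diagonal_generator_def infinitesimal_generator_def diagonal_action_def)
qed

lemma theta_plus_diagonal_generator:
  assumes "x \<in> points Q" "y \<in> points Q"
  shows "theta_plus Q f x y (diagonal_generator G M Q \<Phi> \<xi> x y) = D_snd Q f x y (generator \<xi> y)"
  using tangent_map_snd[OF Q Q assms generator_in_tangent_space diagonal_generator_prod_chart] assms
  by (simp add: theta_plus_def)

lemma theta_minus_diagonal_generator:
  assumes "x \<in> points Q" "y \<in> points Q"
  shows "theta_minus Q f x y (diagonal_generator G M Q \<Phi> \<xi> x y) = D_fst Q f x y (generator \<xi> x)"
  using tangent_map_fst[OF Q Q assms generator_in_tangent_space diagonal_generator_prod_chart] assms
  by (simp add: theta_minus_def)

section \<open>Discrete momentum maps and their conservation\<close>

lemma momentum_plus_eq_minus: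
  assumes f: "Cr_map r (prod_mfd Q Q) euclidean_mfd (\<lambda>(x, y). f x y)" "1 \<le> r"
    and sym: "infinitesimally_symmetric G M Q \<Phi> f" and x: "x \<in> points Q" and y: "y \<in> points Q"
  shows "momentum_plus G M Q \<Phi> f x y = momentum_minus G M Q \<Phi> f x y"
proof -
  have "theta_plus Q f x y (diagonal_generator G M Q \<Phi> \<xi> x y) =
      - theta_minus Q f x y (diagonal_generator G M Q \<Phi> \<xi> x y)" if "\<xi> \<in> lie_algebra G M" for \<xi>
  proof -
    have "D_fst Q f x y (generator \<xi> x) + D_snd Q f x y (generator \<xi> y) = 0"
      using differential_prod[OF Q f x y generator_in_tangent_space[OF x] generator_in_tangent_space[OF y]
          diagonal_generator_prod_chart[OF x y], of \<xi>] sym that x y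
      by (simp add: infinitesimally_symmetric_def)
    then show ?thesis
      by (simp add: theta_plus_diagonal_generator theta_minus_diagonal_generator x y)
  qed
  \<comment> \<open>Off the Lie algebra both restricted functions are \<open>undefined\<close>, so
    agreement on it gives equality of functions.\<close>
  then show ?thesis
    unfolding momentum_plus_def momentum_minus_def by (intro restrict_ext)
qed

lemma momentum_step:
  assumes q: "discrete_EL_solution Q N F q" and k: "k \<in> {1..N - 1}"
  shows "momentum_minus G M Q \<Phi> (F k) (q k) (q (k + 1)) =
           momentum_plus G M Q \<Phi> (F (k - 1)) (q (k - 1)) (q k)"
proof -
  have pts: "q (k - 1) \<in> points Q" "q k \<in> points Q" "q (k + 1) \<in> points Q"
    using q k unfolding discrete_EL_solution_def by auto
  have "D_fst Q (F k) (q k) (q (k + 1)) (generator \<xi> (q k)) +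
      D_snd Q (F (k - 1)) (q (k - 1)) (q k) (generator \<xi> (q k)) = 0" for \<xi>
    using q k generator_in_tangent_space[OF pts(2)] unfolding discrete_EL_solution_def by blast
  then have "- D_fst Q (F k) (q k) (q (k + 1)) (generator \<xi> (q k)) =
      D_snd Q (F (k - 1)) (q (k - 1)) (q k) (generator \<xi> (q k))" for \<xi>
    by (simp only: neg_eq_iff_add_eq_0)
  then show ?thesis
    unfolding momentum_plus_def momentum_minus_def
      theta_plus_diagonal_generator[OF pts(1,2)] theta_minus_diagonal_generator[OF pts(2,3)]
    by (intro restrict_ext)
qed

text \<open>A telescoping chain: coincidence of the two momentum maps at the later pair, then
  \<open>momentum_step\<close> down to the earlier one. The bound \<open>k < N\<close> keeps every
  pair within the solution.\<close>

lemma momentum_conserved: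
  assumes q: "discrete_EL_solution Q N F q"
    and eq: "\<And>k x y. x \<in> points Q \<Longrightarrow> y \<in> points Q \<Longrightarrow>
      momentum_plus G M Q \<Phi> (F k) x y = momentum_minus G M Q \<Phi> (F k) x y"
    and "k < N"
  shows "momentum_plus G M Q \<Phi> (F k) (q k) (q (k + 1)) = momentum_plus G M Q \<Phi> (F 0) (q 0) (q 1)"
  using \<open>k < N\<close>
proof (induction k)
  case (Suc k)
  have "q (Suc k) \<in> points Q" "q (Suc k + 1) \<in> points Q"
    using q Suc.prems unfolding discrete_EL_solution_def by auto
  then show ?case
    using Suc momentum_step[OF q, of "Suc k"] eq by simp
qed simp

end

theorem mainTheorem4:
  fixes Q :: "('q, 'e::euclidean_space) mfd"
    and G :: "'g monoid" and GM :: "('g, 'd::euclidean_space) mfd"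
    and \<Phi> :: "'g \<Rightarrow> 'q \<Rightarrow> 'q"
    and P :: "'w measure"
    and a b h :: real and N :: nat and t :: "nat \<Rightarrow> real"
    and Ld :: "'q \<Rightarrow> 'q \<Rightarrow> real"
    and B :: "real \<Rightarrow> 'q \<Rightarrow> 'q \<Rightarrow> 'w \<Rightarrow> real"
    and L :: "real \<Rightarrow> 'w \<Rightarrow> 'q \<Rightarrow> 'q \<Rightarrow> real"
    and r s :: enat
  assumes "smooth_manifold Q"
    and "prob_space P"
    and "a < b" and "N \<ge> 2"
    and "h = (b - a) / real N" and "\<And>k. t k = a + h * real k"
    and "stochastic_discrete_lagrangian P Q Ld B L"
    and "r \<ge> 1"
    and "\<And>\<tau> \<omega>. \<omega> \<in> space P \<Longrightarrow>
           Cr_map r (prod_mfd Q Q) euclidean_mfd (\<lambda>(x, y). L \<tau> \<omega> x y)"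
    and "s \<ge> 1"
    and "AE \<omega> in P. uniquely_solvable s Q N (\<lambda>k. L (t k) \<omega>)"
    and "lie_group G GM"
    and "smooth_left_action G GM Q \<Phi>"
    and "\<And>\<tau> \<omega>. \<omega> \<in> space P \<Longrightarrow> infinitesimally_symmetric G GM Q \<Phi> (L \<tau> \<omega>)"
  shows "(\<forall>\<tau>. \<forall>\<omega>\<in>space P. \<forall>x\<in>points Q. \<forall>y\<in>points Q.
            momentum_plus G GM Q \<Phi> (L \<tau> \<omega>) x y = momentum_minus G GM Q \<Phi> (L \<tau> \<omega>) x y) \<and>
         (AE \<omega> in P. \<forall>q. discrete_EL_solution Q N (\<lambda>k. L (t k) \<omega>) q \<longrightarrow>
            momentum_plus G GM Q \<Phi> (L (t (N - 1)) \<omega>) (q (N - 1)) (q N) =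
            momentum_plus G GM Q \<Phi> (L (t 0) \<omega>) (q 0) (q 1))"
proof -
  interpret lie_action G GM Q \<Phi>
    by unfold_locales fact+
  have eq: "momentum_plus G GM Q \<Phi> (L \<tau> \<omega>) x y = momentum_minus G GM Q \<Phi> (L \<tau> \<omega>) x y"
    if "\<omega> \<in> space P" "x \<in> points Q" "y \<in> points Q" for \<tau> \<omega> x y
    using momentum_plus_eq_minus assms(8,9,14) that by blast
  \<comment> \<open>The chain ends at the pair with index \<open>N - 1\<close>;
    \<open>N \<ge> 2\<close> turns \<open>N - 1 + 1\<close> into \<open>N\<close>.\<close>
  have "momentum_plus G GM Q \<Phi> (L (t (N - 1)) \<omega>) (q (N - 1)) (q N) =
      momentum_plus G GM Q \<Phi> (L (t 0) \<omega>) (q 0) (q 1)"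
    if "\<omega> \<in> space P" "discrete_EL_solution Q N (\<lambda>k. L (t k) \<omega>) q" for \<omega> q
    using momentum_conserved[OF that(2) eq[OF that(1)], of "N - 1"] \<open>N \<ge> 2\<close> by simp
  with eq show ?thesis by (simp add: AE_I2)
qed

end
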